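(* Let $p_0\ge 1$ be a rational number with continued fraction $p_0=[\nu_0,\nu_1,\ldots,\nu_\alpha]$, and let the integers $y_i,z_i,m_i,n_j$, the signs $\epsilon(j)$, and the symmetric matrix $B=2\Theta$ of size $m_{\alpha+1}$ be those attached to $p_0$ as in the context. For each integer $l\ge 0$ put $$V_l^{(p_0)}(q)=\sum_{\lambda}\frac{q^{\frac12\widetilde\lambda B\widetilde\lambda^{t}}}{\prod_{j=1}^{m_{\alpha+1}}\left(q^{\epsilon(j)};q^{\epsilon(j)}\right)_{\lambda_j}},$$ where the sum is over all sequences of non-negative integers $\lambda=(\lambda_1,\ldots,\lambda_{m_{\alpha+1}})$ with $\sum_{k=1}^{m_{\alpha+1}}n_k\lambda_k=l$, and $\widetilde\lambda=(\widetilde\lambda_1,\ldots,\widetilde\lambda_{m_{\alpha+1}})$ with $\widetilde\lambda_j=\epsilon(j)\lambda_j$. Then $$\sum_{l\ge 0}q^{\frac{l^2}{p_0}}V_l^{(p_0)}(q)=1+\sum_{\substack{k\ge m\ge 0\\ (k,m)\neq(0,0)}}(-1)^{\frac{1+(-1)^{\alpha}}{2}k+m}\,q^{(ky_{\alpha+1}+my_{\alpha})(kz_{\alpha}+mz_{\alpha-1})+\Delta_\alpha(k,m)}\cdot\frac{Q_{k,m}^{((-1)^\alpha)}(q)}{(q;q)_k},$$ where $$Q_{k,m}^{(\pm1)}(q)=q^{\frac{1\mp1}{2}(k+m)}\left[\begin{array}{c}k-1\\ m\end{array}\right]_q+q^{\frac{1\pm1}{2}(2k-m)}\left[\begin{array}{c}k-1\\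 m-1\end{array}\right]_q,$$ $$\Delta_\alpha(k,m)=\frac{1+(-1)^\alpha}{2}\binom{k-m}{2}+\frac{1-(-1)^\alpha}{2}\binom{m}{2}.$$
   Context: Continued fraction: $[\nu_0,\nu_1,\ldots,\nu_\alpha]=\nu_0+\cfrac{1}{\nu_1+\cfrac{1}{\nu_2+\cdots}}$ with positive integers $\nu_i$, and with $\nu_\alpha\ge 2$ if $\alpha>0$ (so the expansion of $p_0$ is unique). Integer sequences: $y_{-1}=0$, $y_0=1$, $y_1=\nu_0$, $y_{i+1}=y_{i-1}+\nu_i y_i$ for $0\le i\le\alpha$; $z_{-1}=0$, $z_0=1$, $z_1=\nu_1$, $z_{i+1}=z_{i-1}+\nu_{i+1}z_i$ (giving $z_i$ for $-1\le i\le\alpha$); $m_0=0$, $m_1=\nu_0$, $m_{i+1}=m_i+\nu_i$ for $0\le i\le\alpha$. For $1\le j\le m_{\alpha+1}$: $r(j)=i$ if $m_i\le j<m_{i+1}$ with $i\le\alpha$, and $r(m_{\alpha+1})=\alpha+1$; $\epsilon(j)=(-1)^{r(j)}$; and $n_j=y_{i-1}+(j-m_i)y_i$ where $i=r(j)$ (in particular $n_{m_{\alpha+1}}=y_\alpha$). The matrix $\Theta$ is defined through its inverse $\Theta^{-1}=(c_{ij})_{1\le i,j\le m_{\alpha+1}}$, the symmetric tridiagonal matrix ($c_{ij}=c_{ji}$, $c_{ij}=0$ if $|i-j|\ge2$) with $c_{j-1,j}=(-1)^{r(j)-1}$ for $2\le j\le m_{\alpha+1}$; $c_{jj}=2(-1)^i$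 if $m_i\le j<m_{i+1}-1$, $i\le\alpha$; $c_{jj}=(-1)^i$ if $j=m_{i+1}-1$, $i\le\alpha$; $c_{jj}=(-1)^{\alpha+1}$ if $j=m_{\alpha+1}$. (Its determinant has absolute value $y_{\alpha+1}$.) Set $B=2\Theta$. $q$-notation: $(a;x)_n=\prod_{i=0}^{n-1}(1-ax^i)$; $\left[\begin{array}{c}M\\ N\end{array}\right]_q=\dfrac{(q;q)_M}{(q;q)_N(q;q)_{M-N}}$ if $0\le N\le M$, and $0$ otherwise. The identity is one of series in $q$, with rational functions of $q$ (including the factors $1/(q^{-1};q^{-1})_n$) expanded around $q=0$. *)

theory Defs
  imports
    "HOL-Analysis.Infinite_Sum"
    "HOL-Library.FuncSet"
    "HOL-Computational_Algebra.Formal_Laurent_Series"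
    "Jordan_Normal_Form.Determinant"
    "Jordan_Normal_Form.Gauss_Jordan_Elimination"
begin

no_notation fps_nth (infixl "$" 75)

fun cfrac :: "nat list \<Rightarrow> rat" where
  "cfrac [] = 0"
| "cfrac [a] = of_nat a"
| "cfrac (a # b # as) = of_nat a + 1 / cfrac (b # as)"

function yseq :: "(nat \<Rightarrow> nat) \<Rightarrow> int \<Rightarrow> nat" where
  "yseq \<nu> i = (if i < 0 then 0 else if i = 0 then 1
              else yseq \<nu> (i - 2) + \<nu> (nat (i - 1)) * yseq \<nu> (i - 1))"
  by pat_completeness auto
termination by (relation "measure (\<lambda>(\<nu>, i). nat (i + 1))") auto

function zseq :: "(nat \<Rightarrow> nat) \<Rightarrow> int \<Rightarrow> nat" where
  "zseq \<nu> i = (if i < 0 then 0 else if i = 0 then 1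
              else zseq \<nu> (i - 2) + \<nu> (nat i) * zseq \<nu> (i - 1))"
  by pat_completeness auto
termination by (relation "measure (\<lambda>(\<nu>, i). nat (i + 1))") auto

declare yseq.simps [simp del] zseq.simps [simp del]

primrec mseq :: "(nat \<Rightarrow> nat) \<Rightarrow> nat \<Rightarrow> nat" where
  "mseq \<nu> 0 = 0"
| "mseq \<nu> (Suc i) = mseq \<nu> i + \<nu> i"

definition msize :: "(nat \<Rightarrow> nat) \<Rightarrow> nat \<Rightarrow> nat" where
  "msize \<nu> \<alpha> = mseq \<nu> (\<alpha> + 1)"

definition rind :: "(nat \<Rightarrow> nat) \<Rightarrow> nat \<Rightarrow> nat \<Rightarrow> nat" where
  "rind \<nu> \<alpha> j = (if j = msize \<nu> \<alpha> then \<alpha> + 1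
                else (THE i. i \<le> \<alpha> \<and> mseq \<nu> i \<le> j \<and> j < mseq \<nu> (i + 1)))"

definition eps :: "(nat \<Rightarrow> nat) \<Rightarrow> nat \<Rightarrow> nat \<Rightarrow> int" where
  "eps \<nu> \<alpha> j = (-1) ^ rind \<nu> \<alpha> j"

definition nseq :: "(nat \<Rightarrow> nat) \<Rightarrow> nat \<Rightarrow> nat \<Rightarrow> nat" where
  "nseq \<nu> \<alpha> j = (let i = rind \<nu> \<alpha> j
                in yseq \<nu> (int i - 1) + (j - mseq \<nu> i) * yseq \<nu> (int i))"

text \<open>
  The entries of the inverse of \<open>\<Theta>\<close>, with indices starting at 1. For \<open>\<nu>\<close> positive and
  \<open>1 \<le> j < msize \<nu> \<alpha>\<close>, the only \<open>i \<le> \<alpha>\<close> for which \<open>mseq \<nu> i \<le> j < mseq \<nu> (i + 1) - 1\<close> or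
  \<open>j = mseq \<nu> (i + 1) - 1\<close> can hold is \<open>rind \<nu> \<alpha> j\<close>.
\<close>

definition cdiag :: "(nat \<Rightarrow> nat) \<Rightarrow> nat \<Rightarrow> nat \<Rightarrow> rat" where
  "cdiag \<nu> \<alpha> j =
     (let i = rind \<nu> \<alpha> j
      in if j = msize \<nu> \<alpha> then (-1) ^ (\<alpha> + 1)
         else if j + 1 = mseq \<nu> (i + 1) then (-1) ^ i
         else 2 * (-1) ^ i)"

definition centry :: "(nat \<Rightarrow> nat) \<Rightarrow> nat \<Rightarrow> nat \<Rightarrow> nat \<Rightarrow> rat" where
  "centry \<nu> \<alpha> i j =
     (if i = j then cdiag \<nu> \<alpha> j
      else if i + 1 = j then (-1) powi (int (rind \<nu> \<alpha> j) - 1)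
      else if j + 1 = i then (-1) powi (int (rind \<nu> \<alpha> i) - 1)
      else 0)"

definition Theta_inv :: "(nat \<Rightarrow> nat) \<Rightarrow> nat \<Rightarrow> rat mat" where
  "Theta_inv \<nu> \<alpha> = mat (msize \<nu> \<alpha>) (msize \<nu> \<alpha>) (\<lambda>(i, j). centry \<nu> \<alpha> (i + 1) (j + 1))"

definition Theta :: "(nat \<Rightarrow> nat) \<Rightarrow> nat \<Rightarrow> rat mat" where
  "Theta \<nu> \<alpha> = the (mat_inverse (Theta_inv \<nu> \<alpha>))"

definition Bmat :: "(nat \<Rightarrow> nat) \<Rightarrow> nat \<Rightarrow> rat mat" where
  "Bmat \<nu> \<alpha> = 2 \<cdot>\<^sub>m Theta \<nu> \<alpha>"

text \<open>
  Series in fractional powers of \<open>q\<close> are represented as formal Laurent series in the variable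
  \<open>t = q\<^bsup>1/y\<^esup>\<close> with \<open>y = yseq \<nu> (\<alpha> + 1)\<close>, so that \<open>q\<^bsup>e\<^esup> = t\<^bsup>y e\<^esup>\<close>. The floor only serves to
  turn the integral rational number \<open>y e\<close> into an integer: \<open>y l\<^sup>2 / p\<^sub>0\<close> and all entries of
  \<open>y \<Theta>\<close> are integers (lemmas \<open>p0_exponent_integral\<close> and \<open>Theta_exponent_integral\<close> below).
  Division and convergence in \<open>rat fls\<close> are those of the field of formal Laurent series with
  the \<open>t\<close>-adic metric, that is, rational functions are expanded around \<open>q = 0\<close>.
\<close>

definition qpow :: "(nat \<Rightarrow> nat) \<Rightarrow> nat \<Rightarrow> rat \<Rightarrow> rat fls" where
  "qpow \<nu> \<alpha> e = fls_X_intpow \<lfloor>of_nat (yseq \<nu> (int \<alpha> + 1)) * e\<rfloor>"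

definition qpoch :: "'a :: field \<Rightarrow> 'a \<Rightarrow> nat \<Rightarrow> 'a" where
  "qpoch a x n = (\<Prod>i<n. 1 - a * x ^ i)"

definition qbinom :: "'a :: field \<Rightarrow> int \<Rightarrow> int \<Rightarrow> 'a" where
  "qbinom q M N =
     (if 0 \<le> N \<and> N \<le> M
      then qpoch q q (nat M) / (qpoch q q (nat N) * qpoch q q (nat (M - N)))
      else 0)"

definition lam_tilde :: "(nat \<Rightarrow> nat) \<Rightarrow> nat \<Rightarrow> (nat \<Rightarrow> nat) \<Rightarrow> rat vec" where
  "lam_tilde \<nu> \<alpha> lam =
     vec (msize \<nu> \<alpha>) (\<lambda>i. of_int (eps \<nu> \<alpha> (i + 1)) * of_nat (lam (i + 1)))"

definition lams :: "(nat \<Rightarrow> nat) \<Rightarrow> nat \<Rightarrow> nat \<Rightarrow> (nat \<Rightarrow> nat) set" where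
  "lams \<nu> \<alpha> l =
     {lam \<in> {1..msize \<nu> \<alpha>} \<rightarrow>\<^sub>E UNIV. (\<Sum>k = 1..msize \<nu> \<alpha>. nseq \<nu> \<alpha> k * lam k) = l}"

definition Vser :: "(nat \<Rightarrow> nat) \<Rightarrow> nat \<Rightarrow> nat \<Rightarrow> rat fls" where
  "Vser \<nu> \<alpha> l =
     (\<Sum>lam \<in> lams \<nu> \<alpha> l.
        qpow \<nu> \<alpha> (1 / 2 * (lam_tilde \<nu> \<alpha> lam \<bullet> (Bmat \<nu> \<alpha> *\<^sub>v lam_tilde \<nu> \<alpha> lam)))
        / (\<Prod>j = 1..msize \<nu> \<alpha>.
             qpoch (qpow \<nu> \<alpha> (of_int (eps \<nu> \<alpha> j))) (qpow \<nu> \<alpha> (of_int (eps \<nu> \<alpha> j))) (lam j)))"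

text \<open>
  In the following two definitions the numerators are even for \<open>s = \<plusminus>1\<close>, so \<open>div\<close> is exact.
\<close>

definition Qpoly :: "int \<Rightarrow> 'a :: field \<Rightarrow> nat \<Rightarrow> nat \<Rightarrow> 'a" where
  "Qpoly s q k m =
     q powi ((1 - s) div 2 * (int k + int m)) * qbinom q (int k - 1) (int m)
     + q powi ((1 + s) div 2 * (2 * int k - int m)) * qbinom q (int k - 1) (int m - 1)"

definition Delta :: "nat \<Rightarrow> nat \<Rightarrow> nat \<Rightarrow> int" where
  "Delta \<alpha> k m = (1 + (-1) ^ \<alpha>) div 2 * int ((k - m) choose 2)
               + (1 - (-1) ^ \<alpha>) div 2 * int (m choose 2)"

text \<open>
  The remaining lemmas show that \<open>\<Theta>\<close> exists, that \<open>qpow\<close> is only applied to exponents with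
  denominator dividing \<open>yseq \<nu> (\<alpha> + 1)\<close>, and that the sum in \<open>Vser\<close> is finite.
\<close>

lemma yseq_step: "yseq \<nu> (int i + 1) = yseq \<nu> (int i - 1) + \<nu> i * yseq \<nu> (int i)"
  by (subst yseq.simps) auto

lemma yseq_base [simp]: "yseq \<nu> (-1) = 0" "yseq \<nu> 0 = 1"
  by (simp_all add: yseq.simps)

lemma yseq_pos: "\<forall>j<i. \<nu> j > 0 \<Longrightarrow> yseq \<nu> (int i) > 0"
proof (induction i)
  case (Suc i)
  then show ?case using yseq_step[of \<nu> i] by (simp add: add.commute)
qed simp

lemma yseq_shift:
  "yseq \<nu> (int n + 2) = \<nu> 0 * yseq (\<lambda>i. \<nu> (Suc i)) (int n + 1) + yseq (\<lambda>i. \<nu> (Suc (Suc i))) (int n)"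
proof (induction n rule: less_induct)
  case (less n)
  let ?a = "\<lambda>i. \<nu> (Suc i)" and ?b = "\<lambda>i. \<nu> (Suc (Suc i))"
  have s: "yseq \<nu> (int n + 2) = yseq \<nu> (int n) + \<nu> (n + 1) * yseq \<nu> (int n + 1)"
    using yseq_step[of \<nu> "n + 1"] by (simp add: algebra_simps)
  consider "n = 0" | "n = 1" | k where "n = k + 2"
    by (metis One_nat_def add_2_eq_Suc' not0_implies_Suc)
  then show ?case
  proof cases
    case 1
    then show ?thesis using s yseq_step[of \<nu> 0] yseq_step[of ?a 0] by simp
  next
    case 2
    then show ?thesis
      using s yseq_step[of \<nu> 0] yseq_step[of \<nu> 1] yseq_step[of ?a 0] yseq_step[of ?a 1]
        yseq_step[of ?b 0] by (simp add: algebra_simps)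
  next
    case 3
    have "yseq \<nu> (int k + 2) = \<nu> 0 * yseq ?a (int k + 1) + yseq ?b (int k)"
      "yseq \<nu> (int (k + 1) + 2) = \<nu> 0 * yseq ?a (int (k + 1) + 1) + yseq ?b (int (k + 1))"
      using less.IH[of k] less.IH[of "k + 1"] 3 by auto
    moreover have "yseq ?a (int k + 3) = yseq ?a (int k + 1) + \<nu> (k + 3) * yseq ?a (int k + 2)"
      "yseq ?b (int k + 2) = yseq ?b (int k) + \<nu> (k + 3) * yseq ?b (int k + 1)"
      using yseq_step[of ?a "k + 2"] yseq_step[of ?b "k + 1"]
      by (simp_all add: algebra_simps numeral_3_eq_3)
    ultimately show ?thesis using s 3 by (simp add: algebra_simps numeral_3_eq_3)
  qed
qed

lemma zseq_eq_yseq: "zseq \<nu> (int i) = yseq (\<lambda>i. \<nu> (Suc i)) (int i)"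
proof (induction i rule: less_induct)
  case (less i)
  consider "i = 0" | "i = 1" | k where "i = k + 2"
    by (metis One_nat_def add_2_eq_Suc' not0_implies_Suc)
  then show ?case
  proof cases
    case 3
    have "nat (2 + int k) = Suc (Suc k)" "nat (1 + int k) = Suc k" by auto
    then show ?thesis using 3 less.IH[of k] less.IH[of "k+1"]
      by (subst zseq.simps, subst yseq.simps) (simp add: algebra_simps)
  qed (simp_all add: zseq.simps yseq.simps)
qed

lemma cfrac_eq:
  "\<forall>i\<le>\<alpha>. \<nu> i > 0 \<Longrightarrow>
     cfrac (map \<nu> [0..<\<alpha> + 1]) = of_nat (yseq \<nu> (int \<alpha> + 1)) / of_nat (zseq \<nu> (int \<alpha>))"
proof (induction \<alpha> arbitrary: \<nu>)
  case 0
  then show ?case using yseq_step[of \<nu> 0] zseq_eq_yseq[of \<nu> 0] by simp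
next
  case (Suc \<alpha>)
  let ?a = "\<lambda>i. \<nu> (Suc i)" and ?b = "\<lambda>i. \<nu> (Suc (Suc i))"
  have e: "map \<nu> [0..<Suc \<alpha> + 1] = \<nu> 0 # map ?a [0..<\<alpha> + 1]"
    by (simp add: map_upt_Suc del: upt_Suc)
  have f: "map ?a [0..<\<alpha> + 1] = \<nu> 1 # map ?b [0..<\<alpha>]"
    by (simp add: map_upt_Suc del: upt_Suc)
  have p: "yseq ?a (int \<alpha> + 1) > 0" "yseq ?b (int \<alpha>) > 0"
    using yseq_pos[of "\<alpha> + 1" ?a] yseq_pos[of \<alpha> ?b] Suc.prems by (auto simp: algebra_simps)
  have "cfrac (map ?a [0..<\<alpha> + 1]) = of_nat (yseq ?a (int \<alpha> + 1)) / of_nat (yseq ?b (int \<alpha>))"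
    using Suc.IH[of ?a] Suc.prems by (simp add: zseq_eq_yseq)
  then have "cfrac (map \<nu> [0..<Suc \<alpha> + 1]) =
      of_nat (\<nu> 0) + of_nat (yseq ?b (int \<alpha>)) / of_nat (yseq ?a (int \<alpha> + 1))"
    unfolding e f by simp
  also have "\<dots> = of_nat (yseq \<nu> (int \<alpha> + 2)) / of_nat (yseq ?a (int \<alpha> + 1))"
    using p by (simp add: yseq_shift field_simps)
  finally show ?case using zseq_eq_yseq[of \<nu> "Suc \<alpha>"] by (simp add: algebra_simps)
qed

lemma p0_exponent_integral:
  assumes "\<forall>i\<le>\<alpha>. \<nu> i > 0" "p0 = cfrac (map \<nu> [0..<\<alpha> + 1])"
  shows "of_nat (yseq \<nu> (int \<alpha> + 1)) * (of_nat l ^ 2 / p0) \<in> \<int>"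
proof -
  have "yseq \<nu> (int \<alpha> + 1) > 0"
    using yseq_pos[of "\<alpha> + 1" \<nu>] assms(1) by (auto simp: algebra_simps)
  then have "of_nat (yseq \<nu> (int \<alpha> + 1)) * (of_nat l ^ 2 / p0)
      = (of_nat (l ^ 2 * zseq \<nu> (int \<alpha>)) :: rat)"
    using assms(2) cfrac_eq[OF assms(1)] by simp
  then show ?thesis by (metis Ints_of_nat)
qed

lemma mseq_mono: "i \<le> j \<Longrightarrow> mseq \<nu> i \<le> mseq \<nu> j"
  by (rule lift_Suc_mono_le) auto

lemma rind_block:
  assumes "i \<le> \<alpha>" "t < \<nu> i"
  shows "mseq \<nu> i + t < msize \<nu> \<alpha>" "rind \<nu> \<alpha> (mseq \<nu> i + t) = i"
proof -
  have "mseq \<nu> (Suc i) \<le> msize \<nu> \<alpha>"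
    unfolding msize_def using mseq_mono[of "Suc i" "\<alpha> + 1" \<nu>] assms(1) by simp
  then show lt: "mseq \<nu> i + t < msize \<nu> \<alpha>" using assms(2) by simp
  have "(THE i'. i' \<le> \<alpha> \<and> mseq \<nu> i' \<le> mseq \<nu> i + t \<and> mseq \<nu> i + t < mseq \<nu> (i' + 1)) = i"
  proof (rule the_equality)
    fix i' assume a: "i' \<le> \<alpha> \<and> mseq \<nu> i' \<le> mseq \<nu> i + t \<and> mseq \<nu> i + t < mseq \<nu> (i' + 1)"
    have "\<not> Suc i \<le> i'" using mseq_mono[of "Suc i" i' \<nu>] a assms(2) by auto
    moreover have "\<not> Suc i' \<le> i" using mseq_mono[of "Suc i'" i \<nu>] a by auto
    ultimately show "i' = i" by simp
  qed (use assms in auto)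
  then show "rind \<nu> \<alpha> (mseq \<nu> i + t) = i" using lt by (simp add: rind_def)
qed

lemma rind_last: "rind \<nu> \<alpha> (msize \<nu> \<alpha>) = \<alpha> + 1"
  by (simp add: rind_def)

lemma block_cases:
  "j < mseq \<nu> (Suc \<alpha>) \<Longrightarrow> \<exists>i t. i \<le> \<alpha> \<and> t < \<nu> i \<and> j = mseq \<nu> i + t"
proof (induction \<alpha>)
  case 0
  then show ?case by (auto intro!: exI[of _ 0] exI[of _ j])
next
  case (Suc \<alpha>)
  show ?case
  proof (cases "j < mseq \<nu> (Suc \<alpha>)")
    case True
    then show ?thesis using Suc.IH by (meson le_SucI)
  next
    case False
    then show ?thesis using Suc.prems
      by (intro exI[of _ "Suc \<alpha>"] exI[of _ "j - mseq \<nu> (Suc \<alpha>)"]) auto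
  qed
qed

lemma nseq_pos:
  assumes "\<forall>i\<le>\<alpha>. \<nu> i > 0" "j \<in> {1..msize \<nu> \<alpha>}"
  shows "nseq \<nu> \<alpha> j > 0"
proof (cases "j = msize \<nu> \<alpha>")
  case True
  have "yseq \<nu> (int \<alpha>) > 0" by (rule yseq_pos) (use assms(1) in auto)
  then show ?thesis unfolding True nseq_def rind_last by (simp add: Let_def)
next
  case False
  then obtain i t where it: "i \<le> \<alpha>" "t < \<nu> i" "j = mseq \<nu> i + t"
    using block_cases[of j \<nu> \<alpha>] assms(2) by (auto simp: msize_def)
  have y: "yseq \<nu> (int i) > 0" by (rule yseq_pos) (use assms(1) it in auto)
  have "t > 0 \<or> yseq \<nu> (int i - 1) > 0"
  proof (cases i)
    case 0
    then show ?thesis using it assms(2) by auto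
  next
    case (Suc k)
    then show ?thesis using yseq_pos[of k \<nu>] assms(1) it by auto
  qed
  then show ?thesis using y it rind_block(2)[of i \<alpha> t \<nu>] by (auto simp: nseq_def)
qed

lemma finite_lams:
  assumes "\<forall>i\<le>\<alpha>. \<nu> i > 0"
  shows "finite (lams \<nu> \<alpha> l)"
proof (rule finite_subset)
  show "finite ({1..msize \<nu> \<alpha>} \<rightarrow>\<^sub>E {..l})" by (intro finite_PiE) auto
  show "lams \<nu> \<alpha> l \<subseteq> {1..msize \<nu> \<alpha>} \<rightarrow>\<^sub>E {..l}"
  proof
    fix f assume f: "f \<in> lams \<nu> \<alpha> l"
    have "f k \<le> l" if k: "k \<in> {1..msize \<nu> \<alpha>}" for k
    proof -
      have "f k \<le> nseq \<nu> \<alpha> k * f k" using nseq_pos[OF assms k] by simp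
      also have "\<dots> \<le> (\<Sum>k = 1..msize \<nu> \<alpha>. nseq \<nu> \<alpha> k * f k)"
        using k by (intro member_le_sum) auto
      finally show ?thesis using f by (simp add: lams_def)
    qed
    then show "f \<in> {1..msize \<nu> \<alpha>} \<rightarrow>\<^sub>E {..l}" using f by (auto simp: lams_def PiE_iff)
  qed
qed

lemma tridiag_core:
  fixes S :: "rat set" and x d :: "nat \<Rightarrow> rat"
  assumes S0: "0 \<in> S" and Sd: "\<And>a b. a \<in> S \<Longrightarrow> b \<in> S \<Longrightarrow> a - b \<in> S"
    and x0: "x 0 = 0" and dS: "\<And>j. d (Suc j) = x (Suc j) - x j"
    and pos: "\<forall>i\<le>\<alpha>. \<nu> i > 0"
    and inner: "\<And>i t. i \<le> \<alpha> \<Longrightarrow> t + 1 < \<nu> i \<Longrightarrow> d (mseq \<nu> i + t + 1) - d (mseq \<nu> i + t) \<in> S"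
    and outer: "\<And>i. i \<le> \<alpha> \<Longrightarrow> x (mseq \<nu> (Suc i)) + d (mseq \<nu> (Suc i) - 1) \<in> S"
    and last: "d (mseq \<nu> (Suc \<alpha>)) \<in> S"
    and j: "j \<le> mseq \<nu> (Suc \<alpha>)"
  shows "of_nat (yseq \<nu> (int \<alpha> + 1)) * x j \<in> S"
proof -
  have Sm: "- a \<in> S" if "a \<in> S" for a using Sd[OF S0 that] by simp
  have Sa: "a + b \<in> S" if "a \<in> S" "b \<in> S" for a b using Sd[OF that(1) Sm[OF that(2)]] by simp
  have Sn: "of_nat n * a \<in> S" if "a \<in> S" for n a
    using S0 by (induction n) (auto simp: algebra_simps intro: Sa that)
  let ?Y = "\<lambda>i. of_nat (yseq \<nu> i) :: rat"
  define A where "A i t = (-1) ^ i * (?Y (int i - 1) + of_nat t * ?Y (int i)) * d 0" for i t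
  define B where "B i = (-1) ^ i * ?Y (int i) * d 0" for i
  have blk: "x (mseq \<nu> i + t) - A i t \<in> S \<and> d (mseq \<nu> i + t) - B i \<in> S"
    if "x (mseq \<nu> i) - A i 0 \<in> S \<and> d (mseq \<nu> i) - B i \<in> S" "i \<le> \<alpha>" "t < \<nu> i" for i t
    using that(3)
  proof (induction t)
    case 0
    then show ?case using that by simp
  next
    case (Suc t)
    let ?j = "mseq \<nu> i + t"
    have IH: "x ?j - A i t \<in> S" "d ?j - B i \<in> S" using Suc by auto
    have "d (?j + 1) - d ?j \<in> S" using inner[OF that(2), of t] Suc.prems by simp
    from Sa[OF this IH(2)] have 1: "d (Suc ?j) - B i \<in> S" by (simp add: algebra_simps)
    have "x (Suc ?j) - A i (Suc t) = (x ?j - A i t) + (d (Suc ?j) - B i)"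
      by (simp add: A_def B_def dS algebra_simps)
    then show ?case using 1 Sa[OF IH(1) 1] by simp
  qed
  have main: "x (mseq \<nu> i) - A i 0 \<in> S \<and> d (mseq \<nu> i) - B i \<in> S" if "i \<le> Suc \<alpha>" for i
    using that
  proof (induction i)
    case 0
    then show ?case using S0 x0 by (simp add: A_def B_def)
  next
    case (Suc i)
    then have i: "i \<le> \<alpha>" and IH: "x (mseq \<nu> i) - A i 0 \<in> S \<and> d (mseq \<nu> i) - B i \<in> S" by auto
    obtain n where n: "\<nu> i = Suc n" using pos i gr0_implies_Suc by blast
    let ?j = "mseq \<nu> i + n"
    have b: "x ?j - A i n \<in> S" "d ?j - B i \<in> S" using blk[OF IH i, of n] n by auto
    have o: "x (Suc ?j) + d ?j \<in> S" using outer[OF i] n by simp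
    have 1: "x (Suc ?j) + B i \<in> S" using Sd[OF o b(2)] by (simp add: algebra_simps)
    have 2: "d (Suc ?j) + B i + A i n \<in> S" using Sd[OF 1 b(1)] by (simp add: dS algebra_simps)
    have y: "?Y (int (Suc i)) = ?Y (int i - 1) + of_nat (Suc n) * ?Y (int i)"
      using yseq_step[of \<nu> i] n by (simp add: algebra_simps)
    have B: "B (Suc i) = - (B i + A i n)"
      unfolding A_def B_def y by (simp add: algebra_simps)
    have e: "x (Suc ?j) - A (Suc i) 0 = x (Suc ?j) + B i"
      "d (Suc ?j) - B (Suc i) = d (Suc ?j) + B i + A i n"
      unfolding B by (simp_all add: A_def B_def)
    show ?case unfolding mseq.simps n add_Suc_right e using 1 2 by blast
  qed
  have "B (Suc \<alpha>) \<in> S"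
    using Sd[OF last conjunct2[OF main[of "Suc \<alpha>"]]] by simp
  then have yd: "?Y (int \<alpha> + 1) * d 0 \<in> S"
    using Sm by (cases "even \<alpha>") (fastforce simp: B_def algebra_simps)+
  have yA: "?Y (int \<alpha> + 1) * A i t \<in> S" for i t
  proof -
    define n where "n = yseq \<nu> (int i - 1) + t * yseq \<nu> (int i)"
    have "?Y (int \<alpha> + 1) * A i t = (-1) ^ i * (of_nat n * (?Y (int \<alpha> + 1) * d 0))"
      by (simp add: A_def n_def algebra_simps)
    moreover have "(-1) ^ i * (of_nat n * (?Y (int \<alpha> + 1) * d 0)) \<in> S"
      using Sn[OF yd, of n] Sm[OF Sn[OF yd, of n]] by (cases "even i") simp_all
    ultimately show ?thesis by (simp only:)
  qed
  obtain i t where it: "x j - A i t \<in> S"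
  proof (cases "j = mseq \<nu> (Suc \<alpha>)")
    case True
    then show ?thesis using main[of "Suc \<alpha>"] that by blast
  next
    case False
    then obtain i t where "i \<le> \<alpha>" "t < \<nu> i" "j = mseq \<nu> i + t"
      using block_cases[of j \<nu> \<alpha>] j by auto
    then show ?thesis using blk[OF main] that by (metis le_SucI)
  qed
  have "?Y (int \<alpha> + 1) * x j = of_nat (yseq \<nu> (int \<alpha> + 1)) * (x j - A i t) + ?Y (int \<alpha> + 1) * A i t"
    by (simp add: algebra_simps)
  then show ?thesis using Sa[OF Sn[OF it] yA] by simp
qed


lemma Theta_inv_mult_vec:
  fixes v :: "rat vec"
  assumes v: "v \<in> carrier_vec (msize \<nu> \<alpha>)" and j: "1 \<le> j" "j \<le> msize \<nu> \<alpha>"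
    and x_def: "\<And>j. x j = (if 1 \<le> j \<and> j \<le> msize \<nu> \<alpha> then v $ (j - 1) else 0)"
  shows "(Theta_inv \<nu> \<alpha> *\<^sub>v v) $ (j - 1) =
    cdiag \<nu> \<alpha> j * x j - (-1) ^ rind \<nu> \<alpha> (j + 1) * x (j + 1) - (-1) ^ rind \<nu> \<alpha> j * x (j - 1)"
proof -
  let ?M = "msize \<nu> \<alpha>"
  have pw: "(-1) powi (int n - 1) = - ((-1) ^ n :: rat)" for n
    by (cases n) (simp_all add: power_int_minus)
  have "(Theta_inv \<nu> \<alpha> *\<^sub>v v) $ (j - 1) = (\<Sum>i\<in>{0..<?M}. centry \<nu> \<alpha> j (i + 1) * v $ i)"
    using v j by (simp add: Theta_inv_def mult_mat_vec_def scalar_prod_def)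
  also have "\<dots> = (\<Sum>i\<in>{1..?M}. centry \<nu> \<alpha> j i * x i)"
    by (rule sum.reindex_bij_witness[of _ "\<lambda>i. i - 1" Suc]) (auto simp: x_def)
  also have "\<dots> = (\<Sum>i\<in>{1..?M}. (if i = j then cdiag \<nu> \<alpha> j * x j else 0)
      + (if i = j + 1 then - ((-1) ^ rind \<nu> \<alpha> (j + 1)) * x (j + 1) else 0)
      + (if i = j - 1 then - ((-1) ^ rind \<nu> \<alpha> j) * x (j - 1) else 0))"
    using j by (intro sum.cong) (auto simp: centry_def pw)
  also have "\<dots> = cdiag \<nu> \<alpha> j * x j - (-1) ^ rind \<nu> \<alpha> (j + 1) * x (j + 1)
      - (-1) ^ rind \<nu> \<alpha> j * x (j - 1)"
    using j by (simp add: sum.distrib) (auto simp: x_def)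
  finally show ?thesis .
qed

lemma Theta_inv_solution:
  fixes v :: "rat vec" and S :: "rat set"
  assumes pos: "\<forall>i\<le>\<alpha>. \<nu> i > 0" and v: "v \<in> carrier_vec (msize \<nu> \<alpha>)"
    and S0: "0 \<in> S" and Sd: "\<And>a b. a \<in> S \<Longrightarrow> b \<in> S \<Longrightarrow> a - b \<in> S"
    and w: "\<And>k. k < msize \<nu> \<alpha> \<Longrightarrow> (Theta_inv \<nu> \<alpha> *\<^sub>v v) $ k \<in> S"
    and k: "k < msize \<nu> \<alpha>"
  shows "of_nat (yseq \<nu> (int \<alpha> + 1)) * v $ k \<in> S"
proof -
  let ?M = "msize \<nu> \<alpha>"
  define x where "x j = (if 1 \<le> j \<and> j \<le> ?M then v $ (j - 1) else 0)" for j
  define d where "d j = (case j of 0 \<Rightarrow> if \<nu> 0 = 1 then - x 1 else x 1 | Suc j \<Rightarrow> x (Suc j) - x j)"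
    for j
  have M: "?M = mseq \<nu> (Suc \<alpha>)" by (simp add: msize_def)
  have sgn: "a \<in> S" if "(-1) ^ i * a \<in> S" for i :: nat and a
    using that Sd[OF S0, of "-a"] by (cases "even i") auto
  have row: "cdiag \<nu> \<alpha> j * x j - (-1) ^ rind \<nu> \<alpha> (j + 1) * x (j + 1)
      - (-1) ^ rind \<nu> \<alpha> j * x (j - 1) \<in> S" if "1 \<le> j" "j \<le> ?M" for j
    using w[of "j - 1"] Theta_inv_mult_vec[OF v that x_def] that by simp
  have zero: "i = 0" if "mseq \<nu> i = 0" "i \<le> \<alpha>" for i
    using that pos by (cases i) (auto dest: Suc_leD)
  have "of_nat (yseq \<nu> (int \<alpha> + 1)) * x (k + 1) \<in> S"
  proof (rule tridiag_core[OF S0 Sd, where d = d and \<alpha> = \<alpha> and \<nu> = \<nu>])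
    fix i t assume i: "i \<le> \<alpha>" and t: "t + 1 < \<nu> i"
    let ?j = "mseq \<nu> i + t"
    show "d (?j + 1) - d ?j \<in> S"
    proof (cases ?j)
      case 0
      then have "i = 0" "t = 0" using zero i by auto
      then show ?thesis using t S0 by (simp add: d_def x_def)
    next
      case (Suc j')
      have r: "rind \<nu> \<alpha> ?j = i" "rind \<nu> \<alpha> (?j + 1) = i" "?j < ?M"
        using rind_block[of i \<alpha> t \<nu>] rind_block[of i \<alpha> "t + 1" \<nu>] i t by auto
      have "cdiag \<nu> \<alpha> ?j = 2 * (-1) ^ i" using r t by (simp add: cdiag_def)
      then have "(-1) ^ i * - (x (?j + 1) - 2 * x ?j + x (?j - 1)) \<in> S"
        using row[of ?j] r Suc by (simp add: algebra_simps)
      from Sd[OF S0 sgn[OF this]] show ?thesis using Suc by (simp add: d_def algebra_simps)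
    qed
  next
    fix i assume i: "i \<le> \<alpha>"
    obtain n where n: "\<nu> i = Suc n" using pos i gr0_implies_Suc by blast
    let ?j = "mseq \<nu> i + n"
    have "x (?j + 1) + d ?j \<in> S"
    proof (cases ?j)
      case 0
      then have "i = 0" "n = 0" using zero i by auto
      then show ?thesis using n S0 by (simp add: d_def)
    next
      case (Suc j')
      have r: "rind \<nu> \<alpha> ?j = i" "?j < ?M" using rind_block[of i \<alpha> n \<nu>] i n by auto
      have r': "rind \<nu> \<alpha> (?j + 1) = Suc i"
      proof (cases "i = \<alpha>")
        case True
        then show ?thesis using rind_last[of \<nu> \<alpha>] n by (simp add: M)
      next
        case False
        then show ?thesis using rind_block(2)[of "Suc i" \<alpha> 0 \<nu>] pos i n by simp
      qed
      have "cdiag \<nu> \<alpha> ?j = (-1) ^ i" using r n by (simp add: cdiag_def)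
      then have "(-1) ^ i * (x (?j + 1) + (x ?j - x (?j - 1))) \<in> S"
        using row[of ?j] r r' Suc by (simp add: algebra_simps)
      from sgn[OF this] show ?thesis using Suc by (simp add: d_def)
    qed
    then show "x (mseq \<nu> (Suc i)) + d (mseq \<nu> (Suc i) - 1) \<in> S" using n by simp
  next
    obtain M' where M': "?M = Suc M'" using k gr0_implies_Suc by fastforce
    have "cdiag \<nu> \<alpha> ?M = (-1) ^ (\<alpha> + 1)" by (simp add: cdiag_def)
    moreover have "x (?M + 1) = 0" by (simp add: x_def)
    ultimately have "(-1) ^ (\<alpha> + 1) * (x ?M - x (?M - 1)) \<in> S"
      using row[of ?M] M' by (simp add: rind_last[of \<nu> \<alpha>, unfolded M'] algebra_simps)
    from sgn[OF this] show "d (mseq \<nu> (Suc \<alpha>)) \<in> S"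
      unfolding M[symmetric] M' by (simp add: d_def)
  qed (use pos k in \<open>auto simp: x_def d_def M simp del: mseq.simps(2)\<close>)
  then show ?thesis using k by (simp add: x_def)
qed

lemma Theta_inverse:
  assumes pos: "\<forall>i\<le>\<alpha>. \<nu> i > 0"
  shows "Theta_inv \<nu> \<alpha> * Theta \<nu> \<alpha> = 1\<^sub>m (msize \<nu> \<alpha>)"
    and "Theta \<nu> \<alpha> * Theta_inv \<nu> \<alpha> = 1\<^sub>m (msize \<nu> \<alpha>)"
    and "Theta \<nu> \<alpha> \<in> carrier_mat (msize \<nu> \<alpha>) (msize \<nu> \<alpha>)"
proof -
  let ?M = "msize \<nu> \<alpha>" and ?A = "Theta_inv \<nu> \<alpha>"
  have A: "?A \<in> carrier_mat ?M ?M" by (simp add: Theta_inv_def)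
  have y: "yseq \<nu> (int \<alpha> + 1) > 0"
    using yseq_pos[of "\<alpha> + 1" \<nu>] pos by (auto simp: algebra_simps)
  have "det ?A \<noteq> 0"
  proof
    assume "det ?A = 0"
    then obtain v where v: "v \<in> carrier_vec ?M" "v \<noteq> 0\<^sub>v ?M" "?A *\<^sub>v v = 0\<^sub>v ?M"
      using det_0_iff_vec_prod_zero_field[OF A] by blast
    have "v $ k = 0" if "k < ?M" for k
      using Theta_inv_solution[OF pos v(1), of "{0}" k] v(3) that y by auto
    then show False using v by (auto simp: vec_eq_iff)
  qed
  then have "mat_inverse ?A \<noteq> None"
    using mat_inverse(1)[OF A, where b = "()"] det_non_zero_imp_unit[OF A, where b = "()"] by blast
  then obtain B where B: "mat_inverse ?A = Some B" by blast
  from mat_inverse(2)[OF A B] show "?A * Theta \<nu> \<alpha> = 1\<^sub>m ?M" "Theta \<nu> \<alpha> * ?A = 1\<^sub>m ?M"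
    "Theta \<nu> \<alpha> \<in> carrier_mat ?M ?M"
    by (simp_all add: Theta_def B)
qed

lemma Theta_exponent_integral:
  assumes pos: "\<forall>i\<le>\<alpha>. \<nu> i > 0"
  shows "of_nat (yseq \<nu> (int \<alpha> + 1))
    * (1 / 2 * (lam_tilde \<nu> \<alpha> lam \<bullet> (Bmat \<nu> \<alpha> *\<^sub>v lam_tilde \<nu> \<alpha> lam))) \<in> \<int>"
proof -
  let ?M = "msize \<nu> \<alpha>" and ?A = "Theta_inv \<nu> \<alpha>" and ?T = "Theta \<nu> \<alpha>"
    and ?l = "lam_tilde \<nu> \<alpha> lam"
  let ?y = "of_nat (yseq \<nu> (int \<alpha> + 1)) :: rat"
  define v where "v = ?T *\<^sub>v ?l"
  note T = Theta_inverse[OF pos]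
  have A: "?A \<in> carrier_mat ?M ?M" by (simp add: Theta_inv_def)
  have l: "?l \<in> carrier_vec ?M" by (simp add: lam_tilde_def)
  have lZ: "?l $ k \<in> \<int>" if "k < ?M" for k using that by (simp add: lam_tilde_def)
  have v: "v \<in> carrier_vec ?M" using T(3) l by (simp add: v_def)
  have "?A *\<^sub>v v = ?l"
    using assoc_mult_mat_vec[OF A T(3) l] T(1) l by (simp add: v_def)
  then have vZ: "?y * v $ k \<in> \<int>" if "k < ?M" for k
    using Theta_inv_solution[OF pos v, of \<int> k] lZ that by auto
  have "Bmat \<nu> \<alpha> *\<^sub>v ?l = 2 \<cdot>\<^sub>v v"
    using T(3) l by (intro eq_vecI) (auto simp: Bmat_def v_def scalar_prod_def sum_distrib_left mult.assoc)
  then have "?y * (1 / 2 * (?l \<bullet> (Bmat \<nu> \<alpha> *\<^sub>v ?l))) = ?y * (?l \<bullet> v)"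
    using v l by simp
  also have "\<dots> = (\<Sum>k\<in>{0..<?M}. ?l $ k * (?y * v $ k))"
    using v by (simp add: scalar_prod_def sum_distrib_left algebra_simps)
  also have "\<dots> \<in> \<int>" by (intro Ints_sum Ints_mult[OF lZ vZ]) auto
  finally show ?thesis .
qed

end

theory Submission
  imports Defs
begin

text \<open>
  The identity holds degree by degree. For every \<open>l\<close>, the series \<open>q\<^bsup>l\<^sup>2/p\<^sub>0\<^esup> V\<^sub>l\<close> is the
  sum of the finitely many terms \<open>(k, m)\<close> of the right-hand side with \<open>k y\<^sub>\<alpha>\<^sub>+\<^sub>1 + m y\<^sub>\<alpha> = l\<close>
  (\<open>refined_identity\<close>). In this form it is an identity between rational functions, so \<open>q\<close> may
  be replaced by \<open>q\<^sup>-\<^sup>1\<close>, and this is what makes an induction along the continued fraction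
  possible; the signs \<open>\<epsilon>(j)\<close> record these replacements. Adding up over \<open>l\<close> is then a
  question of convergence only.

  The induction is a version of Bailey's lemma. Expand
  \<open>(zq; q)\<^sub>\<infinity> / ((q; q)\<^bsub>L-n\<^esub> (zq; q)\<^bsub>L+n\<^esub>)\<close>, the matrix that relates the two members of a
  Bailey pair, in powers of \<open>z\<close>. Up to powers of \<open>q\<close> the coefficients are
  \<open>K\<^sub>q(l, L; i, n) = q\<^bsup>L(l-i) - l(L-n)\<^esup> / ((q\<^sup>-\<^sup>1; q\<^sup>-\<^sup>1)\<^bsub>l-i\<^esub> (q; q)\<^bsub>L-n\<^esub>)\<close>,
  and with the variable \<open>z\<close> replaced by an index pair \<open>(l, i)\<close> on the same footing as
  \<open>(L, n)\<close>, both generators of the continued fraction become visible: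
  \<^item> Bailey's lemma multiplies by one factor \<open>1/(q; q)\<^sub>\<lambda>\<close>, sums over \<open>\<lambda>\<close> and takes the index
    \<open>(i, n)\<close> to \<open>(i + n, n)\<close>. The ratio \<open>i/n\<close> grows by 1 (\<open>bailey_kernel_step\<close>).
  \<^item> Exchanging \<open>(l, i)\<close> with \<open>(L, n)\<close> amounts to inverting \<open>q\<close>. The ratio \<open>i/n\<close> is inverted
    (\<open>bailey_kernel_swap\<close>).

  Starting from the unit Bailey pair (\<open>unit_bailey_pair\<close>), whose coefficients are essentially the
  factors \<open>Q\<^sub>k\<^sub>,\<^sub>m / (q; q)\<^sub>k\<close> of the right-hand side, and applying these two moves as the continued
  fraction prescribes, one obtains \<open>fermionic_sum_bosonic\<close>: a sum over all \<open>\<lambda>\<^sub>j\<close> equals a sum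
  over \<open>(k, m)\<close> against the kernel, taken at two linear forms in \<open>k\<close> and \<open>m\<close>. One last summation
  (\<open>bailey_kernel_final_step\<close>) turns these forms into \<open>k y\<^sub>\<alpha>\<^sub>+\<^sub>1 + m y\<^sub>\<alpha>\<close> and \<open>k z\<^sub>\<alpha> + m z\<^bsub>\<alpha>-1\<^esub>\<close>,
  and replaces the kernel by the power of \<open>q\<close> whose exponent is their product. It takes the place
  of the limit \<open>L \<rightarrow> \<infinity>\<close> in the usual Bailey chain and keeps everything finite.

  It remains to recognise the exponent of \<open>q\<close> (\<open>quadratic_form\<close>). The pairs of summation
  indices met on the way satisfy a recursion that solves the tridiagonal system
  \<open>\<Theta>\<^sup>-\<^sup>1 x = \<lambda>\<close> (with signs) except for a wrong boundary value at 0. Correcting it by a solution of the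
  homogeneous system changes the quadratic form by a Wronskian, which is \<open>-l\<^sup>2/p\<^sub>0\<close> up to an integer.
\<close>

section \<open>Gaussian binomial coefficients\<close>

definition generic :: "'a :: field \<Rightarrow> bool" where
  "generic q \<longleftrightarrow> q \<noteq> 0 \<and> (\<forall>n>0. q ^ n \<noteq> 1)"

abbreviation qfact :: "'a :: field \<Rightarrow> nat \<Rightarrow> 'a" where
  "qfact q n \<equiv> qpoch q q n"

definition gauss :: "'a :: field \<Rightarrow> nat \<Rightarrow> nat \<Rightarrow> 'a" where
  "gauss q n k = (if k \<le> n then qfact q n / (qfact q k * qfact q (n - k)) else 0)"

lemma generic_nonzero: "generic q \<Longrightarrow> q \<noteq> 0"
  by (simp add: generic_def)

lemma generic_power: "generic q \<Longrightarrow> n > 0 \<Longrightarrow> q ^ n \<noteq> 1"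
  by (simp add: generic_def)

lemma generic_inverse: "generic q \<Longrightarrow> generic (inverse q)"
  by (simp add: generic_def power_inverse)

lemma qfact_0 [simp]: "qfact q 0 = 1"
  by (simp add: qpoch_def)

lemma qfact_Suc: "qfact q (Suc n) = qfact q n * (1 - q ^ Suc n)"
  by (simp add: qpoch_def)

lemma qfact_nonzero: "generic q \<Longrightarrow> qfact q n \<noteq> 0"
  by (induction n) (auto simp: qfact_Suc dest: generic_power[of q "Suc _"] simp del: power_Suc)

lemma gauss_0 [simp]: "generic q \<Longrightarrow> gauss q n 0 = 1"
  by (simp add: gauss_def qfact_nonzero)

lemma gauss_self [simp]: "generic q \<Longrightarrow> gauss q n n = 1"
  by (simp add: gauss_def qfact_nonzero)

lemma gauss_eq_0 [simp]: "n < k \<Longrightarrow> gauss q n k = 0"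
  by (simp add: gauss_def)

lemma gauss_Suc_Suc:
  assumes "generic q"
  shows "gauss q (Suc n) (Suc k) = gauss q n k + q ^ Suc k * gauss q n (Suc k)"
proof -
  consider "n < k" | "n = k" | d where "n = Suc (k + d)"
    by (metis less_imp_Suc_add linorder_neqE_nat)
  then show ?thesis
  proof cases
    case 3
    note nz = qfact_nonzero[OF assms]
    have "1 - q ^ Suc k \<noteq> 0" "1 - q ^ Suc d \<noteq> 0"
      using generic_power[OF assms, of "Suc k"] generic_power[OF assms, of "Suc d"] by auto
    then show ?thesis using nz[of "Suc (k + d)"] nz[of k] nz[of d] unfolding 3
      by (simp add: gauss_def qfact_Suc[of q "Suc (k + d)"] qfact_Suc[of q k] qfact_Suc[of q d]
            Suc_diff_le divide_simps del: power_Suc)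
         (simp add: algebra_simps power_add)
  qed (use assms in auto)
qed

lemma gauss_symmetric: "k \<le> n \<Longrightarrow> gauss q n (n - k) = gauss q n k"
  by (simp add: gauss_def mult.commute)

lemma gauss_Suc_Suc':
  assumes "generic q" "k \<le> n"
  shows "gauss q (Suc n) (Suc k) = q ^ (n - k) * gauss q n k + gauss q n (Suc k)"
proof (cases "k = n")
  case False
  then have k: "k < n" using assms by simp
  then have "gauss q (Suc n) (Suc k) = gauss q (Suc n) (Suc (n - Suc k))"
    using gauss_symmetric[of "Suc k" "Suc n" q] by (simp add: Suc_diff_Suc)
  also have "\<dots> = gauss q n (n - Suc k) + q ^ (n - k) * gauss q n (n - k)"
    using gauss_Suc_Suc[OF assms(1), of n "n - Suc k"] k by (simp add: Suc_diff_Suc)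
  finally show ?thesis using k gauss_symmetric[of "Suc k" n q] gauss_symmetric[of k n q]
    by simp
qed (use assms in simp)

text \<open>
  The Cauchy form of the \<open>q\<close>-binomial theorem. As a polynomial identity in \<open>x\<close> it can be used at
  \<open>x = q\<^sup>n\<close>, where it becomes the \<open>q\<close>-Chu-Vandermonde sum behind Bailey's lemma, and at \<open>x = 0\<close>,
  where it becomes the alternating sum that ends the Bailey chain.
\<close>

lemma gauss_expansion_power:
  assumes "generic q"
  shows "(\<Sum>b\<le>n. gauss q n b * (\<Prod>i<b. x - q ^ i)) = x ^ n"
proof (induction n)
  case (Suc n)
  let ?p = "\<lambda>b. \<Prod>i<b. x - q ^ i"
  have "(\<Sum>b\<le>Suc n. gauss q (Suc n) b * ?p b)
      = 1 + (\<Sum>b\<le>n. gauss q n b * ?p (Suc b)) + (\<Sum>b\<le>n. q ^ Suc b * gauss q n (Suc b) * ?p (Suc b))"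
    unfolding sum.atMost_Suc_shift
    by (simp add: gauss_Suc_Suc[OF assms] assms sum.distrib algebra_simps del: prod.lessThan_Suc power_Suc)
  also have "1 + (\<Sum>b\<le>n. gauss q n b * ?p (Suc b)) + (\<Sum>b\<le>n. q ^ Suc b * gauss q n (Suc b) * ?p (Suc b))
      = (\<Sum>b\<le>n. gauss q n b * ?p (Suc b)) + (\<Sum>b\<le>Suc n. q ^ b * gauss q n b * ?p b)"
    unfolding sum.atMost_Suc_shift by (simp add: assms del: prod.lessThan_Suc)
  also have "\<dots> = x * (\<Sum>b\<le>n. gauss q n b * ?p b)"
    by (simp add: sum_distrib_left sum.distrib[symmetric]) (auto intro!: sum.cong simp: algebra_simps)
  finally show ?case by (simp add: Suc)
qed (use assms in simp)

lemma qfact_falling: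
  assumes "generic q" "b \<le> n"
  shows "(\<Prod>i<b. q ^ n - q ^ i) * qfact (inverse q) (n - b) = q ^ (n * b) * qfact (inverse q) n"
  using assms(2)
proof (induction b)
  case (Suc b)
  have q: "q \<noteq> 0" using generic_nonzero assms by auto
  have e: "n - b = Suc (n - Suc b)" using Suc by simp
  have "1 - inverse q ^ (n - b) = (q ^ n - q ^ b) / q ^ n"
    using q Suc.prems by (simp add: field_simps power_diff power_inverse)
  then have "qfact (inverse q) (n - b) * q ^ n = qfact (inverse q) (n - Suc b) * (q ^ n - q ^ b)"
    using q unfolding e qfact_Suc by (simp add: e)
  then have "(\<Prod>i<Suc b. q ^ n - q ^ i) * qfact (inverse q) (n - Suc b)
     = (\<Prod>i<b. q ^ n - q ^ i) * (qfact (inverse q) (n - Suc b) * (q ^ n - q ^ b))"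
    by (simp only: prod.lessThan_Suc ac_simps)
  also have "\<dots> = (\<Prod>i<b. q ^ n - q ^ i) * qfact (inverse q) (n - b) * q ^ n"
    unfolding \<open>_ = qfact (inverse q) (n - Suc b) * (q ^ n - q ^ b)\<close>[symmetric] by (simp only: ac_simps)
  also have "\<dots> = q ^ (n * Suc b) * qfact (inverse q) n"
    using Suc by (simp add: power_add algebra_simps)
  finally show ?case .
qed simp

text \<open>
  The expansion of \<open>x\<^sup>D\<close> at \<open>x = q\<^sup>n\<close>. The products \<open>\<Prod>\<^bsub>i<b\<^esub> (q\<^sup>n - q\<^sup>i)\<close> vanish for \<open>b > n\<close>,
  which is why the sum stops at \<open>n\<close> as well as at \<open>D\<close>.
\<close>

lemma q_Vandermonde:
  assumes "generic q"
  shows "(\<Sum>b\<le>D. if b \<le> n then q ^ (n * b) / (qfact q (D - b) * qfact (inverse q) (n - b) * qfact q b) else 0)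
     = q ^ (D * n) / (qfact (inverse q) n * qfact q D)"
proof -
  note nz = qfact_nonzero[OF assms] qfact_nonzero[OF generic_inverse[OF assms]]
  have "(if b \<le> n then q ^ (n * b) / (qfact q (D - b) * qfact (inverse q) (n - b) * qfact q b) else 0)
      = gauss q D b * (\<Prod>i<b. q ^ n - q ^ i) / (qfact (inverse q) n * qfact q D)" if "b \<le> D" for b
  proof (cases "b \<le> n")
    case True
    have "q ^ (n * b) = (\<Prod>i<b. q ^ n - q ^ i) * qfact (inverse q) (n - b) / qfact (inverse q) n"
      using qfact_falling[OF assms True] nz by (simp add: field_simps)
    then show ?thesis using True that nz by (simp add: gauss_def)
  next
    case False
    then have "(\<Prod>i<b. q ^ n - q ^ i) = 0" by (intro prod_zero) (auto intro!: bexI[of _ n])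
    then show ?thesis using False by simp
  qed
  then have "(\<Sum>b\<le>D. if b \<le> n then q ^ (n * b) / (qfact q (D - b) * qfact (inverse q) (n - b) * qfact q b) else 0)
    = (\<Sum>b\<le>D. gauss q D b * (\<Prod>i<b. q ^ n - q ^ i)) / (qfact (inverse q) n * qfact q D)"
    by (simp add: sum_divide_distrib)
  then show ?thesis
    by (simp add: gauss_expansion_power[OF assms] power_mult[symmetric] mult.commute)
qed

lemma choose_two_add: "(a + b) choose 2 = (a choose 2) + (b choose 2) + a * b"
  by (induction b) (simp_all add: numeral_2_eq_2)

lemma double_choose_two: "2 * (n choose 2) + n = n * n"
  by (induction n) (simp_all add: numeral_2_eq_2)

lemma qfact_inverse:
  assumes "q \<noteq> 0"
  shows "qfact q n = (-1) ^ n * q ^ (Suc n choose 2) * qfact (inverse q) n"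
proof (induction n)
  case (Suc n)
  have e: "1 - q ^ Suc n = - (q ^ Suc n * (1 - inverse q ^ Suc n))"
    using assms by (simp add: field_simps power_inverse)
  have c: "Suc (Suc n) choose 2 = (Suc n choose 2) + Suc n"
    by (simp add: numeral_2_eq_2)
  show ?case unfolding qfact_Suc Suc.IH e c power_add by simp
qed (simp add: numeral_2_eq_2)

text \<open>
  The expansion of \<open>x\<^sup>n\<close> at \<open>x = 0\<close>, where \<open>\<Prod>\<^bsub>i<b\<^esub> (0 - q\<^sup>i) = (-1)\<^sup>b q\<^bsup>b(b-1)/2\<^esup>\<close>. Rewriting
  \<open>(q\<^sup>-\<^sup>1; q\<^sup>-\<^sup>1)\<^bsub>n-b\<^esub>\<close> in terms of \<open>q\<close> supplies the missing powers.
\<close>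

lemma q_binomial_alternating:
  assumes "generic q"
  shows "(\<Sum>b\<le>n. q ^ (n * b) / (qfact (inverse q) (n - b) * qfact q b)) = (if n = 0 then 1 else 0)"
proof -
  note nz = qfact_nonzero[OF assms] qfact_nonzero[OF generic_inverse[OF assms]]
  have q: "q \<noteq> 0" using generic_nonzero assms by auto
  \<comment> \<open>The values at \<open>x = 0\<close> of the products in the expansion.\<close>
  have falling: "(\<Prod>i<b. 0 - q ^ i) = (-1) ^ b * q ^ (b choose 2)" for b
    by (induction b) (simp_all add: numeral_2_eq_2 power_add)
  have "q ^ (n * b) / (qfact (inverse q) (n - b) * qfact q b)
     = gauss q n b * (\<Prod>i<b. 0 - q ^ i) / qfact (inverse q) n" if bn: "b \<le> n" for b
  proof -
    obtain d where d: "n = b + d" using le_Suc_ex[OF bn] by blast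
    define u where "u = (b choose 2)"
    define v where "v = (Suc (b + d) choose 2)"
    define w where "w = (Suc d choose 2)"
    have uv: "q ^ u * q ^ v = q ^ ((b + d) * b) * q ^ w"
    proof -
      have "b + Suc d = Suc (b + d)" by simp
      then have "v = u + w + b * Suc d"
        using choose_two_add[of b "Suc d"] unfolding u_def v_def w_def by (simp only:)
      moreover have "2 * u + b = b * b" unfolding u_def by (rule double_choose_two)
      ultimately have "u + v = (b + d) * b + w" using mult.commute[of b d] unfolding mult_Suc_right ring_distribs by linarith
      then show ?thesis unfolding power_add[symmetric] by (rule arg_cong)
    qed
    have F: "qfact q (b + d) = (-1) ^ b * (-1) ^ d * q ^ v * qfact (inverse q) (b + d)"
      "qfact q d = (-1) ^ d * q ^ w * qfact (inverse q) d"
      using qfact_inverse[OF q, of "b + d"] qfact_inverse[OF q, of d]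
      by (simp_all add: v_def w_def power_add)
    have "qfact q (b + d) * ((-1) ^ b * q ^ u) * qfact (inverse q) d
       = ((-1) ^ b * (-1) ^ b) * (-1) ^ d * (q ^ u * q ^ v) * qfact (inverse q) (b + d)
         * qfact (inverse q) d"
      unfolding F by (simp only: ac_simps)
    also have "\<dots> = q ^ ((b + d) * b) * qfact (inverse q) (b + d) * qfact q d"
      unfolding F(2) uv by (simp add: power_mult_distrib[symmetric])
    finally show ?thesis
      unfolding falling u_def using nz by (simp add: d gauss_def field_simps)
  qed
  then have "(\<Sum>b\<le>n. q ^ (n * b) / (qfact (inverse q) (n - b) * qfact q b))
      = (\<Sum>b\<le>n. gauss q n b * (\<Prod>i<b. 0 - q ^ i)) / qfact (inverse q) n"
    by (simp add: sum_divide_distrib)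
  then show ?thesis unfolding gauss_expansion_power[OF assms] by (simp add: power_0_left)
qed

section \<open>The Bailey kernel\<close>

text \<open>
  Up to a power of \<open>q\<close> this is the coefficient of \<open>z\<^bsup>l-i\<^esup>\<close> in
  \<open>(zq\<^bsup>L+n+1\<^esup>; q)\<^sub>\<infinity> / (q; q)\<^bsub>L-n\<^esub>\<close>. The prefactor is chosen so that the pairs \<open>(l, i)\<close> and
  \<open>(L, n)\<close> play symmetric roles.
\<close>

definition bailey_kernel :: "'a :: field \<Rightarrow> nat \<Rightarrow> nat \<Rightarrow> nat \<Rightarrow> nat \<Rightarrow> 'a" where
  "bailey_kernel q l L i n =
     (if i \<le> l \<and> n \<le> L
      then q powi (int L * int (l - i) - int l * int (L - n))
           / (qfact (inverse q) (l - i) * qfact q (L - n))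
      else 0)"

lemma bailey_kernel_swap: "bailey_kernel q l L i n = bailey_kernel (inverse q) L l n i"
  by (simp add: bailey_kernel_def power_int_inverse power_int_minus[symmetric] mult.commute)

lemma sum_shift_support:
  fixes f :: "nat \<Rightarrow> 'a :: comm_monoid_add"
  assumes "\<And>r. r \<le> l \<Longrightarrow> \<not> (s \<le> r \<and> r \<le> s + n) \<Longrightarrow> f r = 0" "s + n \<le> l"
  shows "(\<Sum>r\<le>l. f r) = (\<Sum>b\<le>n. f (s + b))"
proof -
  have "(\<Sum>r\<le>l. f r) = (\<Sum>r\<in>{s..s + n}. f r)"
    using assms by (intro sum.mono_neutral_right) auto
  also have "\<dots> = (\<Sum>b\<le>n. f (s + b))"
    by (rule sum.reindex_bij_witness[of _ "\<lambda>b. s + b" "\<lambda>r. r - s"]) auto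
  finally show ?thesis .
qed

text \<open>
  Bailey's lemma for the pair \<open>\<alpha>'\<^sub>n = z\<^sup>n q\<^bsup>n\<^sup>2\<^esup> \<alpha>\<^sub>n\<close>,
  \<open>\<beta>'\<^sub>L = \<Sum>\<^sub>r z\<^sup>r q\<^bsup>r\<^sup>2\<^esup> \<beta>\<^sub>r / (q; q)\<^bsub>L-r\<^esub>\<close>, read off coefficientwise in \<open>z\<close>. With \<open>s\<close> and \<open>i\<close> fixed,
  the sum over \<open>r = s + b\<close> is the \<open>q\<close>-Vandermonde sum with parameters \<open>n = l - i - s\<close> and
  \<open>D = L - s\<close>.
\<close>

lemma bailey_kernel_step:
  assumes "generic q"
  shows "(\<Sum>r\<le>min l L. q powi (- int (l * (L - r))) / qfact q (L - r) * bailey_kernel q (l - r) r i s)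
    = bailey_kernel q l L (i + s) s"
proof (cases "i + s \<le> l \<and> s \<le> L")
  case True
  have q: "q \<noteq> 0" using generic_nonzero assms by auto
  note powi_add = power_int_add[of q, OF disjI1[OF q]]
  define n where "n = l - (i + s)"
  define D where "D = L - s"
  have l: "l = i + s + n" and L: "L = s + D" using True by (auto simp: n_def D_def)
  let ?f = "\<lambda>r. q powi (- int (l * (L - r))) / qfact q (L - r) * bailey_kernel q (l - r) r i s"
  let ?c = "q powi (int s * int n - int l * int D)"
  have z: "?f r = 0" if "r \<le> min l L" "\<not> (s \<le> r \<and> r \<le> s + min n D)" for r
    using that by (auto simp: bailey_kernel_def l L)
  have "(\<Sum>r\<le>min l L. ?f r) = (\<Sum>b\<le>min n D. ?f (s + b))"
    by (rule sum_shift_support) (use z in \<open>auto simp: l L\<close>)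
  also have "\<dots> = (\<Sum>b\<le>D. if b \<le> n then ?f (s + b) else 0)"
    by (intro sum.mono_neutral_cong_left) auto
  also have "\<dots> = (\<Sum>b\<le>D. ?c * (if b \<le> n then
        q ^ (n * b) / (qfact q (D - b) * qfact (inverse q) (n - b) * qfact q b) else 0))"
  proof (intro sum.cong refl if_cong)
    fix b assume "b \<in> {..D}"
    show "(if b \<le> n then ?f (s + b) else 0) = ?c * (if b \<le> n then
        q ^ (n * b) / (qfact q (D - b) * qfact (inverse q) (n - b) * qfact q b) else 0)"
    proof (cases "b \<le> n")
      case bn: True
      have k: "bailey_kernel q (l - (s + b)) (s + b) i s
          = q powi (int (s + b) * int (n - b) - int (l - (s + b)) * int b)
            / (qfact (inverse q) (n - b) * qfact q b)"
        using bn by (simp add: bailey_kernel_def l)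
      have e: "- int (l * (D - b)) + (int (s + b) * int (n - b) - int (l - (s + b)) * int b)
          = (int s * int n - int l * int D) + int (n * b)"
      proof -
        obtain d m where "D = b + d" "n = b + m"
          using bn \<open>b \<in> {..D}\<close> by (metis atMost_iff le_Suc_ex)
        then show ?thesis by (simp add: l algebra_simps)
      qed
      have "q powi (- int (l * (D - b))) * q powi (int (s + b) * int (n - b) - int (l - (s + b)) * int b)
          = ?c * q ^ (n * b)"
        unfolding powi_add[symmetric] e unfolding powi_add by (simp only: power_int_of_nat)
      moreover have "L - (s + b) = D - b" by (simp add: L)
      ultimately show ?thesis using bn unfolding k by (simp add: field_simps)
    qed simp
  qed
  also have "\<dots> = ?c * (q ^ (D * n) / (qfact (inverse q) n * qfact q D))"
    by (simp only: sum_distrib_left[symmetric] q_Vandermonde[OF assms])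
  also have "?c * q ^ (D * n) = q powi (int L * int n - int l * int D)"
    using q unfolding power_int_of_nat[symmetric]
    by (simp add: power_int_add[symmetric] L algebra_simps del: power_int_of_nat)
  then have "?c * (q ^ (D * n) / (qfact (inverse q) n * qfact q D)) = bailey_kernel q l L (i + s) s"
    using True by (simp add: bailey_kernel_def n_def D_def)
  finally show ?thesis .
next
  case False
  then show ?thesis by (auto simp: bailey_kernel_def intro!: sum.neutral)
qed

text \<open>
  The same computation with the factor \<open>1/(q; q)\<^bsub>L-r\<^esub>\<close> removed, which is what the Bailey step turns into
  for \<open>L \<rightarrow> \<infinity>\<close>. The Vandermonde sum becomes the alternating one and vanishes unless \<open>l = i + s\<close>.
\<close>

lemma bailey_kernel_final_step:
  assumes "generic q"
  shows "(\<Sum>r\<le>l. q ^ (l * r) * bailey_kernel q (l - r) r i s) = (if l = i + s then q ^ (l * s) else 0)"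
proof (cases "i + s \<le> l")
  case True
  have q: "q \<noteq> 0" using generic_nonzero assms by auto
  note powi_add = power_int_add[of q, OF disjI1[OF q]]
  define n where "n = l - (i + s)"
  have l: "l = i + s + n" using True by (auto simp: n_def)
  let ?f = "\<lambda>r. q ^ (l * r) * bailey_kernel q (l - r) r i s"
  have z: "?f r = 0" if "r \<le> l" "\<not> (s \<le> r \<and> r \<le> s + n)" for r
    using that by (auto simp: bailey_kernel_def l)
  have "(\<Sum>r\<le>l. ?f r) = (\<Sum>b\<le>n. ?f (s + b))"
    by (rule sum_shift_support) (use z in \<open>auto simp: l\<close>)
  also have "\<dots> = (\<Sum>b\<le>n. q ^ (l * s + s * n) * 
        (q ^ (n * b) / (qfact (inverse q) (n - b) * qfact q b)))"
  proof (intro sum.cong refl)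
    fix b assume b: "b \<in> {..n}"
    have k: "bailey_kernel q (l - (s + b)) (s + b) i s
          = q powi (int (s + b) * int (n - b) - int (l - (s + b)) * int b)
            / (qfact (inverse q) (n - b) * qfact q b)"
      using b by (simp add: bailey_kernel_def l)
    have e: "int (l * (s + b)) + (int (s + b) * int (n - b) - int (l - (s + b)) * int b)
        = int (l * s + s * n) + int (n * b)"
    proof -
      obtain m where "n = b + m" using b le_Suc_ex by auto
      then show ?thesis by (simp add: l algebra_simps)
    qed
    have "q ^ (l * (s + b)) * q powi (int (s + b) * int (n - b) - int (l - (s + b)) * int b)
        = q ^ (l * s + s * n) * q ^ (n * b)"
      unfolding power_int_of_nat[symmetric] powi_add[symmetric] e ..
    then show "?f (s + b) = q ^ (l * s + s * n) * 
        (q ^ (n * b) / (qfact (inverse q) (n - b) * qfact q b))"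
      unfolding k by (simp add: field_simps)
  qed
  also have "\<dots> = q ^ (l * s + s * n) * (if n = 0 then 1 else 0)"
    by (simp only: sum_distrib_left[symmetric] q_binomial_alternating[OF assms])
  also have "\<dots> = (if l = i + s then q ^ (l * s) else 0)" by (simp add: l)
  finally show ?thesis .
next
  case False
  then show ?thesis by (auto simp: bailey_kernel_def intro!: sum.neutral)
qed

section \<open>The unit Bailey pair\<close>

text \<open>
  For \<open>k > 0\<close> this is \<open>(-1)\<^bsup>k+m\<^esup> q\<^bsup>\<Delta>\<^esup> Q\<^sub>k\<^sub>,\<^sub>m\<^sup>(\<^sup>+\<^sup>) / (q; q)\<^sub>k\<close> with the \<open>\<Delta>\<close> of an even \<open>\<alpha>\<close>. The version
  for an odd \<open>\<alpha>\<close> arises by inverting \<open>q\<close> (\<open>bosonic_coeff_odd\<close>).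
\<close>

definition bosonic_coeff :: "'a :: field \<Rightarrow> nat \<Rightarrow> nat \<Rightarrow> 'a" where
  "bosonic_coeff q k m =
     (if k = 0 then (if m = 0 then 1 else 0)
      else (-1) ^ (k + m) * q ^ ((k - m) choose 2)
           * (gauss q (k - 1) m + q ^ (2 * k - m) * (if m = 0 then 0 else gauss q (k - 1) (m - 1)))
           / qfact q k)"

text \<open>
  The product \<open>(zq; q)\<^sub>k\<close> as a polynomial in the power series variable \<open>z\<close>.
\<close>

definition poch_head :: "'a :: field \<Rightarrow> nat \<Rightarrow> 'a fps" where
  "poch_head q k = (\<Prod>i<k. 1 - fps_const (q ^ Suc i) * fps_X)"

text \<open>
  The product \<open>(zq\<^bsup>k+1\<^esup>; q)\<^sub>\<infinity>\<close>, given by Euler's expansion in powers of \<open>z\<close> because the infinite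
  product does not converge in the \<open>z\<close>-adic sense. Its characteristic property is \<open>poch_tail_step\<close>.
\<close>

definition poch_tail :: "'a :: field \<Rightarrow> nat \<Rightarrow> 'a fps" where
  "poch_tail q k = Abs_fps (\<lambda>j. q ^ (k * j) / qfact (inverse q) j)"

text \<open>
  The member \<open>\<alpha>\<^sub>k = (-1)\<^sup>k q\<^bsup>k(k-1)/2\<^esup> (1 - zq\<^bsup>2k\<^esup>) (z; q)\<^sub>k / ((1 - z) (q; q)\<^sub>k)\<close> of the unit Bailey pair
  relative to \<open>z\<close>.
\<close>

definition unit_alpha :: "'a :: field \<Rightarrow> nat \<Rightarrow> 'a fps" where
  "unit_alpha q k = (if k = 0 then 1 else
     fps_const ((-1) ^ k * q ^ (k choose 2) / qfact q k)
     * ((1 - fps_const (q ^ (2 * k)) * fps_X) * poch_head q (k - 1)))"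

lemma fps_nth_linear_factor:
  fixes f :: "'a :: field fps"
  shows "fps_nth ((1 - fps_const c * fps_X) * f) m
     = fps_nth f m - (if m = 0 then 0 else c * fps_nth f (m - 1))"
proof -
  have "(1 - fps_const c * fps_X) * f = f - fps_const c * (fps_X * f)"
    by (simp add: algebra_simps)
  then show ?thesis by (simp only: fps_sub_nth fps_mult_left_const_nth fps_X_mult_nth) simp
qed

lemma poch_head_nth:
  assumes "generic q"
  shows "fps_nth (poch_head q k) m = (-1) ^ m * q ^ (Suc m choose 2) * gauss q k m"
proof (induction k arbitrary: m)
  case 0
  then show ?case by (cases m) (auto simp: poch_head_def assms numeral_2_eq_2)
next
  case (Suc k)
  have "poch_head q (Suc k) = (1 - fps_const (q ^ Suc k) * fps_X) * poch_head q k"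
    by (simp add: poch_head_def mult.commute del: power_Suc)
  then have *: "fps_nth (poch_head q (Suc k)) m
     = fps_nth (poch_head q k) m - (if m = 0 then 0 else q ^ Suc k * fps_nth (poch_head q k) (m - 1))"
    by (simp only: fps_nth_linear_factor)
  show ?case
  proof (cases m)
    case (Suc i)
    have c: "Suc (Suc i) choose 2 = (Suc i choose 2) + Suc i" by (simp add: numeral_2_eq_2)
    show ?thesis
    proof (cases "i \<le> k")
      case True
      then have "q ^ Suc k = q ^ Suc i * q ^ (k - i)" by (simp flip: power_add)
      then show ?thesis unfolding * unfolding Suc.IH \<open>m = Suc i\<close> gauss_Suc_Suc'[OF assms True] c power_add
        by (simp add: algebra_simps power_Suc[of "- 1 :: 'a"] del: power_Suc)
    next
      case False
      then show ?thesis unfolding * unfolding Suc.IH \<open>m = Suc i\<close> by simp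
    qed
  next
    case 0
    then show ?thesis unfolding * unfolding Suc.IH by (simp add: assms numeral_2_eq_2)
  qed
qed

lemma poch_tail_step:
  assumes "generic q"
  shows "poch_tail q k = (1 - fps_const (q ^ Suc k) * fps_X) * poch_tail q (Suc k)"
proof (rule fps_ext)
  fix j
  have q: "q \<noteq> 0" using generic_nonzero assms by auto
  show "fps_nth (poch_tail q k) j
      = fps_nth ((1 - fps_const (q ^ Suc k) * fps_X) * poch_tail q (Suc k)) j"
  proof (cases j)
    case (Suc i)
    have nz: "qfact (inverse q) i \<noteq> 0" "1 - inverse q ^ Suc i \<noteq> 0"
      using qfact_nonzero[OF generic_inverse[OF assms]]
        generic_power[OF generic_inverse[OF assms], of "Suc i"] by auto
    have r: "q ^ (Suc k * Suc i) * inverse q ^ Suc i = q ^ (k * Suc i)"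
      using q by (simp add: power_add power_inverse field_simps)
    have s: "q ^ Suc k * q ^ (Suc k * i) = q ^ (Suc k * Suc i)" by (simp flip: power_add)
    have "q ^ (Suc k * Suc i) / qfact (inverse q) (Suc i) - q ^ (Suc k * Suc i) / qfact (inverse q) i
       = q ^ (Suc k * Suc i) * inverse q ^ Suc i / qfact (inverse q) (Suc i)"
    proof -
      have "a / p - a / b = a * (1 - y) / p" if "p = b * y" "b \<noteq> 0" "y \<noteq> 0" for a b p y :: 'a
        using that by (simp add: field_simps)
      from this[OF qfact_Suc nz] show ?thesis by (simp only: diff_diff_eq2 add_diff_cancel_left')
    qed
    then show ?thesis unfolding fps_nth_linear_factor Suc
      by (simp add: poch_tail_def r s del: power_Suc mult_Suc mult_Suc_right)
  qed (simp add: fps_nth_linear_factor poch_tail_def)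
qed

text \<open>
  The two Gaussian coefficients in \<open>Q\<^sub>k\<^sub>,\<^sub>m\<close> come from the two terms of the factor \<open>1 - zq\<^bsup>2k\<^esup>\<close>.
\<close>

lemma unit_alpha_nth:
  assumes "generic q"
  shows "fps_nth (unit_alpha q k) m = q ^ (k * m) * bosonic_coeff q k m"
proof (cases "k = 0")
  case False
  let ?g = "gauss q (k - 1) m" and ?g' = "if m = 0 then 0 else gauss q (k - 1) (m - 1)"
  have "fps_nth (unit_alpha q k) m = (-1) ^ k * q ^ (k choose 2) / qfact q k
     * ((-1) ^ m * q ^ (Suc m choose 2) * ?g
        - (if m = 0 then 0 else q ^ (2 * k) * ((-1) ^ (m - 1) * q ^ (m choose 2) * gauss q (k - 1) (m - 1))))"
    using False unfolding unit_alpha_def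
    by (simp add: fps_nth_linear_factor poch_head_nth[OF assms] del: mult_Suc mult_Suc_right binomial_Suc_Suc)
  also have "\<dots> = (-1) ^ (k + m) / qfact q k * (q ^ ((k choose 2) + (Suc m choose 2)) * ?g
        + q ^ (2 * k + (k choose 2) + (m choose 2)) * ?g')"
    by (cases m) (simp_all add: power_add algebra_simps del: mult_Suc mult_Suc_right)
  also have "q ^ ((k choose 2) + (Suc m choose 2)) * ?g = q ^ (k * m + ((k - m) choose 2)) * ?g"
  proof (cases "m \<le> k")
    case True
    then obtain d where k: "k = m + d" using le_Suc_ex by blast
    have "Suc m choose 2 = (m choose 2) + m" by (simp add: numeral_2_eq_2)
    then have "(k choose 2) + (Suc m choose 2) = k * m + ((k - m) choose 2)"
      using choose_two_add[of m d] double_choose_two[of m] k by (simp add: ring_distribs)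
    then show ?thesis by (simp only:)
  qed simp
  also have "q ^ (2 * k + (k choose 2) + (m choose 2)) * ?g'
      = q ^ (k * m + ((k - m) choose 2)) * q ^ (2 * k - m) * ?g'"
  proof (cases "m \<le> k")
    case True
    then obtain d where k: "k = m + d" using le_Suc_ex by blast
    have "2 * k + (k choose 2) + (m choose 2) = (k * m + ((k - m) choose 2)) + (2 * k - m)"
      using choose_two_add[of m d] double_choose_two[of m] k by (simp add: ring_distribs)
    then show ?thesis by (simp only: power_add)
  qed (use False in simp)
  finally show ?thesis using False
    by (cases "m = 0") (simp_all add: bosonic_coeff_def power_add algebra_simps add_divide_distrib)
qed (auto simp: unit_alpha_def bosonic_coeff_def)

text \<open>
  The defining sum of the unit Bailey pair, multiplied by \<open>(zq; q)\<^sub>\<infinity>\<close>, has partial sums in closed form.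
  After removal of common factors, the induction step is the polynomial identity
  \<open>(1 - uv)(1 - u\<^sup>2z) - (1 - u)(1 - u\<^sup>2vz) = u(1 - v)(1 - uz)\<close> with \<open>u = q\<^bsup>M+1\<^esup>\<close> and \<open>v = q\<^bsup>n-M-1\<^esup>\<close>.
\<close>

lemma unit_telescope:
  assumes "generic q" "M < n"
  shows "(\<Sum>k\<le>M. unit_alpha q k * fps_const (1 / qfact q (n - k)) * poch_tail q (n + k))
     = fps_const ((-1) ^ M * q ^ (Suc M choose 2) / (qfact q M * qfact q (n - Suc M) * (1 - q ^ n)))
       * poch_head q M * poch_tail q (n + M)"
  using assms(2)
proof (induction M)
  case 0
  then have "qfact q n = qfact q (n - Suc 0) * (1 - q ^ n)"
    using qfact_Suc[of q "n - 1"] by simp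
  then show ?case by (simp add: unit_alpha_def poch_head_def numeral_2_eq_2)
next
  case (Suc M)
  define m where "m = Suc M"
  \<comment> \<open>The constant that all three terms of the step have in common.\<close>
  define c where "c = - ((-1) ^ M * q ^ (Suc M choose 2) / (qfact q m * qfact q (n - m) * (1 - q ^ n)))"
  define u where "u = q ^ m"
  define v where "v = q ^ (n - m)"
  define x where "x = 1 - u"
  define y where "y = 1 - v"
  define w where "w = 1 - u * v"
  let ?C = fps_const
  have uv: "q ^ n = u * v" "q ^ (2 * m) = u * u" "q ^ (n + m) = u * u * v"
  proof -
    obtain d where d: "n = m + d" using Suc.prems le_Suc_ex[of m n] by (auto simp: m_def)
    show "q ^ n = u * v" "q ^ (2 * m) = u * u" "q ^ (n + m) = u * u * v"
      by (simp_all add: d u_def v_def power_add mult_2)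
  qed
  have nz: "qfact q j \<noteq> 0" "x \<noteq> 0" "w \<noteq> 0" "y \<noteq> 0" for j
    using qfact_nonzero[OF assms(1)] generic_power[OF assms(1), of m]
      generic_power[OF assms(1), of n] generic_power[OF assms(1), of "n - m"] Suc.prems uv(1)
    by (auto simp: u_def v_def m_def x_def y_def w_def)
  have f: "qfact q m = qfact q M * x" "qfact q (n - m) = qfact q (n - Suc m) * y"
    using qfact_Suc[of q M] qfact_Suc[of q "n - Suc m"] Suc.prems
    by (simp_all add: u_def v_def m_def x_def y_def Suc_diff_Suc del: power_Suc)
  have ch: "Suc m choose 2 = (Suc M choose 2) + m" by (simp add: numeral_2_eq_2 m_def)
  have c1: "(-1) ^ M * q ^ (Suc M choose 2) / (qfact q M * qfact q (n - Suc M) * (1 - q ^ n)) = - x * c"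
    using nz unfolding c_def f(1) uv m_def[symmetric] w_def[symmetric] by (simp add: field_simps)
  have c2: "(-1) ^ m * q ^ (m choose 2) / qfact q m * (1 / qfact q (n - m)) = w * c"
    using nz unfolding c_def uv w_def[symmetric] by (simp add: m_def field_simps)
  have c3: "(-1) ^ m * q ^ (Suc m choose 2) / (qfact q m * qfact q (n - Suc m) * (1 - q ^ n)) = u * y * c"
    using nz unfolding c_def uv ch f(2) power_add u_def[symmetric] w_def[symmetric] by (simp add: m_def field_simps)
  have hd: "poch_head q m = poch_head q M * (1 - ?C u * fps_X)"
    by (simp add: poch_head_def m_def u_def del: power_Suc)
  have tl: "poch_tail q (n + M) = (1 - ?C (u * u * v) * fps_X) * poch_tail q (n + m)"
    using poch_tail_step[OF assms(1), of "n + M"] by (simp add: m_def flip: uv(3))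
  have al: "unit_alpha q m * ?C (1 / qfact q (n - m))
      = ?C (w * c) * ((1 - ?C (u * u) * fps_X) * poch_head q M)"
    unfolding c2[symmetric] fps_const_mult[symmetric] unit_alpha_def uv(2)
    by (simp add: m_def)
  have key: "?C (- x * c) * (1 - ?C (u * u * v) * fps_X) + ?C (w * c) * (1 - ?C (u * u) * fps_X)
      = ?C (u * y * c) * (1 - ?C u * fps_X)"
    unfolding x_def y_def w_def fps_const_mult[symmetric] fps_const_sub[symmetric] fps_const_neg[symmetric] fps_const_1_eq_1
    by (simp add: algebra_simps)
  have "(\<Sum>k\<le>m. unit_alpha q k * ?C (1 / qfact q (n - k)) * poch_tail q (n + k))
     = ?C (- x * c) * poch_head q M * poch_tail q (n + M)
       + unit_alpha q m * ?C (1 / qfact q (n - m)) * poch_tail q (n + m)"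
    using Suc unfolding c1[symmetric] m_def by simp
  also have "\<dots> = (?C (- x * c) * (1 - ?C (u * u * v) * fps_X) + ?C (w * c) * (1 - ?C (u * u) * fps_X))
      * poch_head q M * poch_tail q (n + m)"
  proof -
    have "a * h * (x1 * t) + b * (x2 * h) * t = (a * x1 + b * x2) * h * t" for a b h t x1 x2 :: "'a fps"
      by (simp add: algebra_simps)
    then show ?thesis unfolding tl al .
  qed
  also have "\<dots> = ?C (u * y * c) * poch_head q m * poch_tail q (n + m)"
    unfolding key hd by (simp only: ac_simps)
  finally show ?case unfolding c3[symmetric] m_def .
qed

text \<open>
  The last step of the telescope is separate since its closed form would contain \<open>1/(q; q)\<^sub>-\<^sub>1 = 0\<close>.
\<close>

lemma unit_sum_zero:
  assumes "generic q" "n > 0"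
  shows "(\<Sum>k\<le>n. unit_alpha q k * fps_const (1 / qfact q (n - k)) * poch_tail q (n + k)) = 0"
proof -
  obtain M where M: "n = Suc M" using assms(2) gr0_implies_Suc by blast
  have nz: "qfact q M \<noteq> 0" "1 - q ^ n \<noteq> 0"
    using qfact_nonzero[OF assms(1)] generic_power[OF assms] by auto
  have f: "qfact q n = qfact q M * (1 - q ^ n)" unfolding M by (rule qfact_Suc)
  have tl: "poch_tail q (n + M) = (1 - fps_const (q ^ (2 * n)) * fps_X) * poch_tail q (n + n)"
    using poch_tail_step[OF assms(1), of "n + M"] by (simp add: M mult_2)
  have "(\<Sum>k\<le>n. unit_alpha q k * fps_const (1 / qfact q (n - k)) * poch_tail q (n + k))
     = (\<Sum>k\<le>M. unit_alpha q k * fps_const (1 / qfact q (n - k)) * poch_tail q (n + k))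
       + unit_alpha q n * poch_tail q (n + n)"
    by (simp add: M)
  also have "\<dots> = fps_const ((-1) ^ M * q ^ (n choose 2) / (qfact q M * (1 - q ^ n)))
       * poch_head q M * poch_tail q (n + M) + unit_alpha q n * poch_tail q (n + n)"
    using unit_telescope[OF assms(1), of M n] by (simp add: M)
  also have al: "unit_alpha q n = - fps_const ((-1) ^ M * q ^ (n choose 2) / (qfact q M * (1 - q ^ n)))
       * ((1 - fps_const (q ^ (2 * n)) * fps_X) * poch_head q M)"
    unfolding unit_alpha_def f by (simp add: M)
  also have "a * h * (x * t) + - a * (x * h) * t = 0" for a h x t :: "'a fps"
    by (simp add: algebra_simps)
  then have "fps_const c * poch_head q M * poch_tail q (n + M)
      + - fps_const c * ((1 - fps_const (q ^ (2 * n)) * fps_X) * poch_head q M) * poch_tail q (n + n) = 0"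
    for c unfolding tl .
  finally show ?thesis .
qed

text \<open>
  The coefficient of \<open>z\<^sup>j\<close> in the preceding identity. The bound \<open>B\<close> is free because the kernel vanishes for
  \<open>k > n\<close>; this makes it possible to keep one and the same range of summation through the induction on the
  continued fraction.
\<close>

lemma unit_bailey_pair:
  assumes "generic q" "n \<le> B"
  shows "(\<Sum>k\<le>B. \<Sum>m\<le>k. bosonic_coeff q k m * bailey_kernel q j n m k)
    = (if n = 0 then 1 / qfact (inverse q) j else 0)"
proof -
  have q: "q \<noteq> 0" using generic_nonzero assms by auto
  have zero: "bosonic_coeff q k m = 0" if "m > k" for k m
    using that by (auto simp: bosonic_coeff_def)
  have "(\<Sum>k\<le>B. \<Sum>m\<le>k. bosonic_coeff q k m * bailey_kernel q j n m k)
      = (\<Sum>k\<le>n. \<Sum>m\<le>j. bosonic_coeff q k m * bailey_kernel q j n m k)"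
  proof -
    have "(\<Sum>m\<le>k. bosonic_coeff q k m * bailey_kernel q j n m k)
       = (\<Sum>m\<le>j. bosonic_coeff q k m * bailey_kernel q j n m k)" for k
      by (rule sum.mono_neutral_cong) (auto simp: zero bailey_kernel_def)
    then have "(\<Sum>k\<le>B. \<Sum>m\<le>k. bosonic_coeff q k m * bailey_kernel q j n m k)
      = (\<Sum>k\<le>B. \<Sum>m\<le>j. bosonic_coeff q k m * bailey_kernel q j n m k)" by (simp only:)
    also have "\<dots> = (\<Sum>k\<le>n. \<Sum>m\<le>j. bosonic_coeff q k m * bailey_kernel q j n m k)"
      by (rule sum.mono_neutral_right) (use assms in \<open>auto simp: bailey_kernel_def\<close>)
    finally show ?thesis .
  qed
  also have "\<dots> = (\<Sum>k\<le>n. q powi (- int (n * j)) *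
      fps_nth (unit_alpha q k * fps_const (1 / qfact q (n - k)) * poch_tail q (n + k)) j)"
  proof (intro sum.cong refl)
    fix k assume k: "k \<in> {..n}"
    have t: "bosonic_coeff q k m * bailey_kernel q j n m k
      = q powi (- int (n * j)) * (1 / qfact q (n - k) * (fps_nth (unit_alpha q k) m * fps_nth (poch_tail q (n + k)) (j - m)))"
      if m: "m \<in> {..j}" for m
    proof -
      have e: "int n * int (j - m) - int j * int (n - k) = - int (n * j) + (int (k * m) + int ((n + k) * (j - m)))"
      proof -
        obtain a b where "j = m + a" "n = k + b" using m k le_Suc_ex by (metis atMost_iff)
        then show ?thesis by (simp add: algebra_simps)
      qed
      have "q powi (int n * int (j - m) - int j * int (n - k))
         = q powi (- int (n * j)) * (q ^ (k * m) * q ^ ((n + k) * (j - m)))"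
        unfolding e power_int_add[of q, OF disjI1[OF q]] power_int_of_nat ..
      then show ?thesis using m k
        by (simp add: bailey_kernel_def unit_alpha_nth[OF assms(1)] poch_tail_def ac_simps)
    qed
    have "fps_nth (unit_alpha q k * fps_const (1 / qfact q (n - k)) * poch_tail q (n + k)) j
      = 1 / qfact q (n - k) * (\<Sum>m\<le>j. fps_nth (unit_alpha q k) m * fps_nth (poch_tail q (n + k)) (j - m))"
    proof -
      have "unit_alpha q k * fps_const (1 / qfact q (n - k)) * poch_tail q (n + k)
        = fps_const (1 / qfact q (n - k)) * (unit_alpha q k * poch_tail q (n + k))"
        by (simp only: ac_simps)
      then show ?thesis by (simp only: fps_mult_left_const_nth) (simp only: fps_mult_nth atLeast0AtMost)
    qed
    then show "(\<Sum>m\<le>j. bosonic_coeff q k m * bailey_kernel q j n m k) = q powi (- int (n * j)) *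
        fps_nth (unit_alpha q k * fps_const (1 / qfact q (n - k)) * poch_tail q (n + k)) j"
      by (simp only: t sum_distrib_left cong: sum.cong)
  qed
  also have "\<dots> = q powi (- int (n * j)) *
      fps_nth (\<Sum>k\<le>n. unit_alpha q k * fps_const (1 / qfact q (n - k)) * poch_tail q (n + k)) j"
    by (simp only: fps_sum_nth sum_distrib_left)
  also have "\<dots> = (if n = 0 then 1 / qfact (inverse q) j else 0)"
  proof (cases "n = 0")
    case True
    then show ?thesis by (simp add: unit_alpha_def poch_tail_def)
  next
    case False
    then show ?thesis using unit_sum_zero[OF assms(1)] by simp
  qed
  finally show ?thesis .
qed

section \<open>Bosonic coefficients and inversion of \<open>q\<close>\<close>

lemma gauss_inverse:
  assumes "generic q" "b \<le> n"
  shows "gauss q n b = q ^ (b * (n - b)) * gauss (inverse q) n b"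
proof -
  obtain d where n: "n = b + d" using le_Suc_ex[OF assms(2)] by blast
  have q: "q \<noteq> 0" using generic_nonzero assms by auto
  note nz = qfact_nonzero[OF generic_inverse[OF assms(1)]]
  have "Suc b choose 2 = (b choose 2) + b" by (simp add: numeral_2_eq_2)
  then have e: "Suc (b + d) choose 2 = (b * d + (Suc b choose 2)) + (Suc d choose 2)"
    using choose_two_add[of b "Suc d"] unfolding add_Suc_right mult_Suc_right by linarith
  show ?thesis using assms(2) nz q
    unfolding gauss_def n qfact_inverse[OF q, of "b + d"] qfact_inverse[OF q, of b]
    by (simp add: qfact_inverse[OF q, of d] e power_add field_simps del: binomial_Suc_Suc)
qed

lemma qbinom_eq_gauss: "qbinom q (int n) (int b) = gauss q n b"
  by (auto simp: qbinom_def gauss_def nat_diff_distrib simp flip: of_nat_diff)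

lemma qbinom_pred:
  assumes "k > 0"
  shows "qbinom q (int k - 1) (int m) = gauss q (k - 1) m"
    and "qbinom q (int k - 1) (int m - 1) = (if m = 0 then 0 else gauss q (k - 1) (m - 1))"
proof -
  have k: "int k - 1 = int (k - 1)" using assms by simp
  show "qbinom q (int k - 1) (int m) = gauss q (k - 1) m" unfolding k by (rule qbinom_eq_gauss)
  show "qbinom q (int k - 1) (int m - 1) = (if m = 0 then 0 else gauss q (k - 1) (m - 1))"
  proof (cases m)
    case (Suc i)
    then show ?thesis unfolding k using qbinom_eq_gauss[of q "k - 1" i] by simp
  qed (simp add: qbinom_def)
qed

lemma bosonic_coeff_even:
  assumes "m \<le> k" "k > 0"
  shows "bosonic_coeff q k m = (-1) ^ (k + m) * q ^ ((k - m) choose 2) * (Qpoly 1 q k m / qfact q k)"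
proof -
  have "q powi (2 * int k - int m) = q ^ (2 * k - m)"
    using assms power_int_of_nat[of q "2 * k - m"] by (simp add: of_nat_diff)
  then show ?thesis using assms
    by (simp add: bosonic_coeff_def Qpoly_def qbinom_pred)
qed

text \<open>
  The numerators \<open>Q\<^sup>(\<^sup>+\<^sup>)\<close> and \<open>Q\<^sup>(\<^sup>-\<^sup>)\<close> are exchanged by \<open>q \<mapsto> q\<^sup>-\<^sup>1\<close>. The sign \<open>(-1)\<^sup>k\<close> is absorbed by
  \<open>(q\<^sup>-\<^sup>1; q\<^sup>-\<^sup>1)\<^sub>k\<close>, and the quadratic exponents match because
  \<open>k(k+1)/2 = m(m-1)/2 + d(d-1)/2 + md + k\<close> for \<open>k = m + d\<close>.
\<close>

lemma bosonic_coeff_odd: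
  assumes "generic q" "m \<le> k" "k > 0"
  shows "bosonic_coeff (inverse q) k m = (-1) ^ m * q ^ (m choose 2) * (Qpoly (-1) q k m / qfact q k)"
proof -
  let ?p = "inverse q"
  have q: "q \<noteq> 0" using generic_nonzero assms by auto
  obtain d where k: "k = m + d" using le_Suc_ex[OF assms(2)] by blast
  have ks: "Suc k choose 2 = (m choose 2) + (d choose 2) + m * d + k"
    using choose_two_add[of m d] by (simp add: k numeral_2_eq_2)
  have g1: "q ^ (Suc k choose 2) * ?p ^ (d choose 2) * gauss ?p (k - 1) m
      = q ^ (m choose 2) * (q ^ (k + m) * gauss q (k - 1) m)"
  proof (cases d)
    case (Suc e)
    have "Suc k choose 2 = (d choose 2) + ((m choose 2) + (k + m) + m * (k - 1 - m))"
      unfolding ks by (simp add: k Suc)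
    moreover have "gauss q (k - 1) m = q ^ (m * (k - 1 - m)) * gauss ?p (k - 1) m"
      by (rule gauss_inverse) (use assms Suc k in auto)
    ultimately show ?thesis using q by (simp add: power_add power_inverse)
  qed (use k assms in simp)
  have g2: "q ^ (Suc k choose 2) * ?p ^ (d choose 2) * (?p ^ (2 * k - m) * gauss ?p (k - 1) (m - 1))
      = q ^ (m choose 2) * gauss q (k - 1) (m - 1)" if mpos: "m > 0"
  proof -
    obtain j where m: "m = Suc j" using gr0_implies_Suc[OF mpos] by blast
    have "Suc k choose 2 = (d choose 2) + (2 * k - m) + ((m choose 2) + (m - 1) * (k - 1 - (m - 1)))"
      unfolding ks by (simp add: k m)
    moreover have "gauss q (k - 1) (m - 1) = q ^ ((m - 1) * (k - 1 - (m - 1))) * gauss ?p (k - 1) (m - 1)"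
      by (rule gauss_inverse) (use assms in auto)
    ultimately show ?thesis using q by (simp add: power_add power_inverse) (simp add: field_simps)
  qed
  have g: "q ^ (Suc k choose 2) * ?p ^ (d choose 2)
      * (gauss ?p (k - 1) m + ?p ^ (2 * k - m) * (if m = 0 then 0 else gauss ?p (k - 1) (m - 1)))
      = q ^ (m choose 2) * (q ^ (k + m) * gauss q (k - 1) m + (if m = 0 then 0 else gauss q (k - 1) (m - 1)))"
    using g1 g2 by (cases "m = 0") (simp_all add: distrib_left)
  have Q: "Qpoly (-1) q k m = q ^ (k + m) * gauss q (k - 1) m + (if m = 0 then 0 else gauss q (k - 1) (m - 1))"
    using power_int_of_nat[of q "k + m"] by (simp add: Qpoly_def qbinom_pred assms)
  have f: "1 / qfact ?p k = (-1) ^ k * q ^ (Suc k choose 2) / qfact q k"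
    using q unfolding qfact_inverse[OF q, of k] by simp
  have dk: "k - m = d" by (simp add: k)
  have "bosonic_coeff ?p k m = (-1) ^ (k + m) * ?p ^ (d choose 2)
      * (gauss ?p (k - 1) m + ?p ^ (2 * k - m) * (if m = 0 then 0 else gauss ?p (k - 1) (m - 1)))
      * (1 / qfact ?p k)"
    using assms by (simp add: bosonic_coeff_def dk)
  also have "\<dots> = ((-1) ^ (k + m) * (-1) ^ k) * (q ^ (Suc k choose 2) * ?p ^ (d choose 2)
      * (gauss ?p (k - 1) m + ?p ^ (2 * k - m) * (if m = 0 then 0 else gauss ?p (k - 1) (m - 1))))
      / qfact q k"
    unfolding f by (simp only: times_divide_eq_right times_divide_eq_left ac_simps)
  also have "(-1) ^ (k + m) * (-1) ^ k = ((-1) ^ m :: 'a)"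
    by (simp add: power_add power_mult_distrib[symmetric] mult.assoc[symmetric] mult.commute)
  finally show ?thesis unfolding g Q by simp
qed

section \<open>Fermionic sums over words\<close>

text \<open>
  A continued fraction is encoded as a word of truth values, one for each \<open>j = 0, \<dots>, m\<^sub>\<alpha>\<^sub>+\<^sub>1 - 1\<close>. Each
  letter stands for one Bailey step; the letter is \<open>True\<close> if \<open>j\<close> is the last index of its block, and
  then the Bailey step is followed by an exchange of the two indices and an inversion of \<open>q\<close>.

  If the entries of \<open>xs\<close> are the summation variables \<open>L - r\<close> of the successive Bailey steps, then
  \<open>state w xs\<close> is the pair of upper indices \<open>(l, L)\<close> at which the process must have been started; it is computed
  from the end, where the index \<open>l\<close> has become 0.
\<close>

primrec state :: "bool list \<Rightarrow> nat list \<Rightarrow> nat \<times> nat" where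
  "state [] xs = (0, hd xs)"
| "state (t # w) xs =
     (let (a, b) = state w (tl xs) in (a + b, (if t then a else b) + hd xs))"

text \<open>
  The exponent of \<open>q\<close> accumulated in the Bailey steps, each of which contributes \<open>- l (L - r)\<close>. Its sign changes with
  every inversion of \<open>q\<close>.
\<close>

primrec energy :: "bool list \<Rightarrow> nat list \<Rightarrow> int" where
  "energy [] xs = 0"
| "energy (t # w) xs =
     (if t then - energy w (tl xs) else energy w (tl xs)) - int (fst (state (t # w) xs) * hd xs)"

primrec weight :: "'a :: field \<Rightarrow> bool list \<Rightarrow> nat list \<Rightarrow> 'a" where
  "weight q [] xs = qfact q (hd xs)"
| "weight q (t # w) xs = qfact q (hd xs) * weight (if t then inverse q else q) w (tl xs)"

text \<open>
  The lower indices to which the two moves take the index pair \<open>(k, m)\<close> of the unit Bailey pair.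
\<close>

primrec coord :: "bool list \<Rightarrow> nat \<Rightarrow> nat \<Rightarrow> nat \<times> nat" where
  "coord [] k m = (k, m)"
| "coord (t # w) k m = (let (a, b) = coord w k m in (a + b, if t then a else b))"

text \<open>
  The base, \<open>q\<close> or \<open>q\<^sup>-\<^sup>1\<close>, that is in force at the end of the word.
\<close>

primrec end_base :: "'a :: field \<Rightarrow> bool list \<Rightarrow> 'a" where
  "end_base q [] = q"
| "end_base q (t # w) = end_base (if t then inverse q else q) w"

definition configs :: "bool list \<Rightarrow> nat \<Rightarrow> nat \<Rightarrow> nat list set" where
  "configs w l L = {xs. length xs = Suc (length w) \<and> state w xs = (l, L)}"

definition fermionic_sum :: "'a :: field \<Rightarrow> bool list \<Rightarrow> nat \<Rightarrow> nat \<Rightarrow> 'a" where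
  "fermionic_sum q w l L = (\<Sum>xs\<in>configs w l L. q powi energy w xs / weight q w xs)"

lemma configs_Nil: "configs [] l L = (if l = 0 then {[L]} else {})"
  by (auto simp: configs_def length_Suc_conv)

lemma configs_Cons:
  "configs (t # w) l L =
     (\<Union>r\<le>min l L. (#) (L - r) ` configs w (if t then r else l - r) (if t then l - r else r))"
proof (rule Set.set_eqI, rule iffI)
  fix xs assume "xs \<in> configs (t # w) l L"
  then obtain x ys where xs: "xs = x # ys" "length ys = Suc (length w)"
    and st: "state (t # w) (x # ys) = (l, L)"
    by (auto simp: configs_def length_Suc_conv)
  obtain a b where ab: "state w ys = (a, b)" by fastforce
  show "xs \<in> (\<Union>r\<le>min l L. (#) (L - r) ` configs w (if t then r else l - r) (if t then l - r else r))"
    using st xs ab by (intro UN_I[of "if t then a else b"]) (auto simp: configs_def)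
qed (auto simp: configs_def split: if_splits)

lemma finite_configs: "finite (configs w l L)"
  by (induction w arbitrary: l L) (auto simp: configs_Nil configs_Cons)

lemma sum_configs_Cons:
  "(\<Sum>xs\<in>configs (t # w) l L. f xs) =
     (\<Sum>r\<le>min l L. \<Sum>xs\<in>configs w (if t then r else l - r) (if t then l - r else r). f ((L - r) # xs))"
proof -
  have "(\<Sum>xs\<in>configs (t # w) l L. f xs) =
     (\<Sum>r\<le>min l L. \<Sum>xs\<in>(#) (L - r) ` configs w (if t then r else l - r) (if t then l - r else r). f xs)"
    unfolding configs_Cons
    by (rule sum.UNION_disjoint) (auto simp: finite_configs)
  also have "\<dots> = (\<Sum>r\<le>min l L. \<Sum>xs\<in>configs w (if t then r else l - r) (if t then l - r else r). f ((L - r) # xs))"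
    by (rule sum.cong[OF refl]) (simp add: sum.reindex)
  finally show ?thesis .
qed

text \<open>
  The fermionic sum obeys the recursion of the Bailey chain: its first summation variable \<open>L - r\<close> is a Bailey step.
\<close>

lemma fermionic_sum_Cons:
  assumes "q \<noteq> 0"
  shows "fermionic_sum q (t # w) l L =
    (\<Sum>r\<le>min l L. q powi (- int (l * (L - r))) / qfact q (L - r)
      * (if t then fermionic_sum (inverse q) w r (l - r) else fermionic_sum q w (l - r) r))"
proof -
  note powi_add = power_int_add[of q, OF disjI1[OF assms]]
  have "fermionic_sum q (t # w) l L = (\<Sum>r\<le>min l L.
     \<Sum>xs\<in>configs w (if t then r else l - r) (if t then l - r else r).
       q powi energy (t # w) ((L - r) # xs) / weight q (t # w) ((L - r) # xs))"
    unfolding fermionic_sum_def by (rule sum_configs_Cons)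
  also have "\<dots> = (\<Sum>r\<le>min l L. \<Sum>xs\<in>configs w (if t then r else l - r) (if t then l - r else r).
      q powi (- int (l * (L - r))) / qfact q (L - r) *
       ((if t then inverse q else q) powi energy w xs / weight (if t then inverse q else q) w xs))"
  proof (intro sum.cong refl)
    fix r xs assume r: "r \<in> {..min l L}"
      and xs: "xs \<in> configs w (if t then r else l - r) (if t then l - r else r)"
    then have "fst (state (t # w) ((L - r) # xs)) = l"
      by (auto simp: configs_def)
    then have "energy (t # w) ((L - r) # xs)
        = - int (l * (L - r)) + (if t then - energy w xs else energy w xs)"
      by (simp del: state.simps)
    moreover have "(if t then inverse q else q) powi energy w xs
        = q powi (if t then - energy w xs else energy w xs)"
      by (simp add: power_int_inverse power_int_minus)
    ultimately show "q powi energy (t # w) ((L - r) # xs) / weight q (t # w) ((L - r) # xs)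
       = q powi (- int (l * (L - r))) / qfact q (L - r) *
       ((if t then inverse q else q) powi energy w xs / weight (if t then inverse q else q) w xs)"
      by (simp only: powi_add weight.simps list.sel times_divide_times_eq)
  qed
  also have "\<dots> = (\<Sum>r\<le>min l L. q powi (- int (l * (L - r))) / qfact q (L - r)
      * (if t then fermionic_sum (inverse q) w r (l - r) else fermionic_sum q w (l - r) r))"
    by (simp only: sum_distrib_left[symmetric] fermionic_sum_def) (cases t; simp)
  finally show ?thesis .
qed

text \<open>
  For the empty word this is the unit Bailey pair, read with exchanged indices and inverted \<open>q\<close>. A letter in front is a
  Bailey step, preceded for \<open>True\<close> by the symmetry of the kernel. The sum \<open>l + L\<close> of the upper indices can only
  decrease, so that one bound \<open>B\<close> serves for all of them.
\<close>

theorem fermionic_sum_bosonic: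
  assumes "generic q" "l + L \<le> B"
  shows "fermionic_sum q w l L = (\<Sum>k\<le>B. \<Sum>m\<le>k.
     bosonic_coeff (inverse (end_base q w)) k m
     * bailey_kernel q l L (fst (coord w k m)) (snd (coord w k m)))"
  using assms
proof (induction w arbitrary: q l L)
  case Nil
  have q: "q \<noteq> 0" using generic_nonzero Nil by auto
  have "fermionic_sum q [] l L = (if l = 0 then 1 / qfact q L else 0)"
    by (simp add: fermionic_sum_def configs_Nil)
  also have "\<dots> = (\<Sum>k\<le>B. \<Sum>m\<le>k. bosonic_coeff (inverse q) k m * bailey_kernel (inverse q) L l m k)"
    using unit_bailey_pair[OF generic_inverse[OF Nil(1)], of l B L] Nil(2) by simp
  finally show ?case by (simp add: bailey_kernel_swap[of q])
next
  case (Cons t w)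
  let ?p = "if t then inverse q else q"
  let ?c = "\<lambda>k m. bosonic_coeff (inverse (end_base ?p w)) k m"
  have q: "q \<noteq> 0" using generic_nonzero Cons by auto
  have "fermionic_sum q (t # w) l L = (\<Sum>r\<le>min l L. q powi (- int (l * (L - r))) / qfact q (L - r)
      * (if t then fermionic_sum (inverse q) w r (l - r) else fermionic_sum q w (l - r) r))"
    by (rule fermionic_sum_Cons[OF q])
  also have "\<dots> = (\<Sum>r\<le>min l L. q powi (- int (l * (L - r))) / qfact q (L - r)
      * (\<Sum>k\<le>B. \<Sum>m\<le>k. ?c k m * bailey_kernel q (l - r) r
           (if t then snd (coord w k m) else fst (coord w k m)) (if t then fst (coord w k m) else snd (coord w k m))))"
  proof (intro sum.cong refl arg_cong2[of _ _ _ _ "(*)"])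
    fix r assume "r \<in> {..min l L}"
    then show "(if t then fermionic_sum (inverse q) w r (l - r) else fermionic_sum q w (l - r) r)
       = (\<Sum>k\<le>B. \<Sum>m\<le>k. ?c k m * bailey_kernel q (l - r) r
           (if t then snd (coord w k m) else fst (coord w k m)) (if t then fst (coord w k m) else snd (coord w k m)))"
      using Cons.IH[of ?p "if t then r else l - r" "if t then l - r else r"] Cons.prems
        generic_inverse[OF Cons.prems(1)] bailey_kernel_swap[of q "l - r" r]
      by (cases t) auto
  qed
  also have "\<dots> = (\<Sum>k\<le>B. \<Sum>m\<le>k. ?c k m * (\<Sum>r\<le>min l L. q powi (- int (l * (L - r))) / qfact q (L - r) *
       bailey_kernel q (l - r) r
           (if t then snd (coord w k m) else fst (coord w k m)) (if t then fst (coord w k m) else snd (coord w k m))))"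
    unfolding sum_distrib_left
    by (subst sum.swap, rule sum.cong[OF refl], subst sum.swap, intro sum.cong refl) (simp only: ac_simps)
  also have "\<dots> = (\<Sum>k\<le>B. \<Sum>m\<le>k. ?c k m *
      bailey_kernel q l L (fst (coord (t # w) k m)) (snd (coord (t # w) k m)))"
    unfolding bailey_kernel_step[OF Cons.prems(1)]
    by (intro sum.cong refl) (auto simp: Let_def case_prod_beta add.commute)
  finally show ?case by simp
qed

text \<open>
  The first letter of the word is special: its Bailey step has no factor \<open>1/(q; q)\<^bsub>L-r\<^esub>\<close> (in the usual Bailey
  chain, \<open>L = \<infinity>\<close> there), and it leaves no kernel behind.
\<close>

lemma fermionic_sum_total:
  assumes "generic q"
  shows "(\<Sum>r\<le>l. q ^ (l * r) * (if t then fermionic_sum (inverse q) w r (l - r) else fermionic_sum q w (l - r) r))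
    = (\<Sum>k\<le>l. \<Sum>m\<le>k. bosonic_coeff (inverse (end_base q (t # w))) k m *
        (if fst (coord (t # w) k m) = l then q ^ (l * snd (coord (t # w) k m)) else 0))"
proof -
  let ?p = "if t then inverse q else q"
  let ?c = "\<lambda>k m. bosonic_coeff (inverse (end_base ?p w)) k m"
  have "(\<Sum>r\<le>l. q ^ (l * r) * (if t then fermionic_sum (inverse q) w r (l - r) else fermionic_sum q w (l - r) r))
    = (\<Sum>r\<le>l. q ^ (l * r) * (\<Sum>k\<le>l. \<Sum>m\<le>k. ?c k m * bailey_kernel q (l - r) r
           (if t then snd (coord w k m) else fst (coord w k m)) (if t then fst (coord w k m) else snd (coord w k m))))"
  proof (intro sum.cong refl arg_cong2[of _ _ _ _ "(*)"])
    fix r assume "r \<in> {..l}"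
    then show "(if t then fermionic_sum (inverse q) w r (l - r) else fermionic_sum q w (l - r) r)
       = (\<Sum>k\<le>l. \<Sum>m\<le>k. ?c k m * bailey_kernel q (l - r) r
           (if t then snd (coord w k m) else fst (coord w k m)) (if t then fst (coord w k m) else snd (coord w k m)))"
      using fermionic_sum_bosonic[of ?p "if t then r else l - r" "if t then l - r else r" l w] assms
        generic_inverse[OF assms] bailey_kernel_swap[of q "l - r" r]
      by (cases t) auto
  qed
  also have "\<dots> = (\<Sum>k\<le>l. \<Sum>m\<le>k. ?c k m * (\<Sum>r\<le>l. q ^ (l * r) *
       bailey_kernel q (l - r) r
           (if t then snd (coord w k m) else fst (coord w k m)) (if t then fst (coord w k m) else snd (coord w k m))))"
    unfolding sum_distrib_left
    by (subst sum.swap, rule sum.cong[OF refl], subst sum.swap, intro sum.cong refl) (simp only: ac_simps)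
  also have "\<dots> = (\<Sum>k\<le>l. \<Sum>m\<le>k. bosonic_coeff (inverse (end_base q (t # w))) k m *
        (if fst (coord (t # w) k m) = l then q ^ (l * snd (coord (t # w) k m)) else 0))"
    unfolding bailey_kernel_final_step[OF assms]
    by (intro sum.cong refl) (auto simp: Let_def case_prod_beta add.commute)
  finally show ?thesis .
qed

definition total_configs :: "bool list \<Rightarrow> nat \<Rightarrow> nat list set" where
  "total_configs w l = {xs. length xs = Suc (length w) \<and> fst (state w xs) + snd (state w xs) = l}"

text \<open>
  The sum over \<open>r\<close> and the sums over the remaining variables merge into one sum over all lists of variables.
\<close>

lemma fermionic_identity:
  assumes "generic q"
  shows "(\<Sum>xs\<in>total_configs w l.
      q powi (int l * int (if t then fst (state w xs) else snd (state w xs))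
              + (if t then - energy w xs else energy w xs))
      / weight (if t then inverse q else q) w xs)
    = (\<Sum>k\<le>l. \<Sum>m\<le>k. bosonic_coeff (inverse (end_base q (t # w))) k m *
        (if fst (coord (t # w) k m) = l then q ^ (l * snd (coord (t # w) k m)) else 0))"
proof -
  have q: "q \<noteq> 0" using generic_nonzero assms by auto
  have T: "total_configs w l = (\<Union>r\<le>l. configs w (if t then r else l - r) (if t then l - r else r))"
  proof (rule Set.set_eqI, rule iffI)
    fix xs assume "xs \<in> total_configs w l"
    then show "xs \<in> (\<Union>r\<le>l. configs w (if t then r else l - r) (if t then l - r else r))"
      by (intro UN_I[of "if t then fst (state w xs) else snd (state w xs)"])
         (auto simp: total_configs_def configs_def)
  qed (auto simp: total_configs_def configs_def split: if_splits)
  let ?f = "\<lambda>xs. q powi (int l * int (if t then fst (state w xs) else snd (state w xs))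
              + (if t then - energy w xs else energy w xs))
      / weight (if t then inverse q else q) w xs"
  have "(\<Sum>xs\<in>total_configs w l. ?f xs)
     = (\<Sum>r\<le>l. \<Sum>xs\<in>configs w (if t then r else l - r) (if t then l - r else r). ?f xs)"
    unfolding T by (rule sum.UNION_disjoint, simp_all only: finite_configs) (auto simp: configs_def)
  also have "\<dots> = (\<Sum>r\<le>l. \<Sum>xs\<in>configs w (if t then r else l - r) (if t then l - r else r).
      q ^ (l * r) * ((if t then inverse q else q) powi energy w xs / weight (if t then inverse q else q) w xs))"
  proof (intro sum.cong refl)
    fix r xs assume "xs \<in> configs w (if t then r else l - r) (if t then l - r else r)"
    then have r: "(if t then fst (state w xs) else snd (state w xs)) = r"
      by (auto simp: configs_def)
    have "(if t then inverse q else q) powi energy w xs = q powi (if t then - energy w xs else energy w xs)"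
      by (simp add: power_int_inverse power_int_minus)
    then show "?f xs = q ^ (l * r) *
        ((if t then inverse q else q) powi energy w xs / weight (if t then inverse q else q) w xs)"
      unfolding r by (simp only: power_int_add[of q, OF disjI1[OF q]] of_nat_mult[symmetric]
          power_int_of_nat times_divide_eq_right)
  qed
  also have "\<dots> = (\<Sum>r\<le>l. q ^ (l * r) *
      (if t then fermionic_sum (inverse q) w r (l - r) else fermionic_sum q w (l - r) r))"
    by (simp only: sum_distrib_left[symmetric] fermionic_sum_def) (cases t; simp)
  finally show ?thesis unfolding fermionic_sum_total[OF assms] .
qed

section \<open>The word of a continued fraction\<close>

text \<open>
  The recursion for the pairs of indices, the recursions for \<open>y\<^sub>i\<close> and \<open>z\<^sub>i\<close> and the homogeneous tridiagonal
  system are all products of the same elementary \<open>2 \<times> 2\<close> matrices. Here a row vector \<open>(f, g)\<close> is propagated forwards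
  and a column vector \<open>(a, b)\<close> backwards, so that their product changes only by the inhomogeneous terms.
\<close>

lemma functional_invariant:
  fixes a b f g x :: "nat \<Rightarrow> 'a :: comm_semiring_1"
  assumes "s \<le> e"
    and a: "\<And>j. s \<le> j \<Longrightarrow> j < e \<Longrightarrow> a j = a (Suc j) + b (Suc j)"
    and b: "\<And>j. s \<le> j \<Longrightarrow> j < e \<Longrightarrow> b j = (if T j then a (Suc j) else b (Suc j)) + x j"
    and f: "\<And>j. s \<le> j \<Longrightarrow> j < e \<Longrightarrow> f (Suc j) = (if T j then g j + f j else f j)"
    and g: "\<And>j. s \<le> j \<Longrightarrow> j < e \<Longrightarrow> g (Suc j) = (if T j then f j else g j + f j)"
  shows "f s * a s + g s * b s = f e * a e + g e * b e + (\<Sum>j = s..<e. g j * x j)"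
  using assms
proof (induction e)
  case (Suc e)
  show ?case
  proof (cases "s = Suc e")
    case False
    then have s: "s \<le> e" using Suc.prems(1) by simp
    have "f s * a s + g s * b s = f e * a e + g e * b e + (\<Sum>j = s..<e. g j * x j)"
      using Suc s by simp
    also have "f e * a e + g e * b e = f (Suc e) * a (Suc e) + g (Suc e) * b (Suc e) + g e * x e"
      using Suc.prems(2-5)[OF s] by (simp add: algebra_simps)
    finally show ?thesis using s by (simp add: ac_simps)
  qed simp
qed simp

text \<open>
  The last indices of the blocks; \<open>0\<close> is counted as an index of the first block.
\<close>

definition outer :: "(nat \<Rightarrow> nat) \<Rightarrow> nat \<Rightarrow> nat \<Rightarrow> bool" where
  "outer \<nu> \<alpha> j \<longleftrightarrow> j + 1 = mseq \<nu> (rind \<nu> \<alpha> j + 1)"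

definition cf_word :: "(nat \<Rightarrow> nat) \<Rightarrow> nat \<Rightarrow> nat \<Rightarrow> bool list" where
  "cf_word \<nu> \<alpha> s = map (outer \<nu> \<alpha>) [s..<msize \<nu> \<alpha>]"

lemma zseq_step: "zseq \<nu> (int i + 1) = zseq \<nu> (int i - 1) + \<nu> (Suc i) * zseq \<nu> (int i)"
  by (subst zseq.simps) (auto simp: nat_add_distrib)

lemma zseq_base [simp]: "zseq \<nu> (-1) = 0" "zseq \<nu> 0 = 1"
  by (simp_all add: zseq.simps)

locale continued_fraction =
  fixes \<nu> :: "nat \<Rightarrow> nat" and \<alpha> :: nat
  assumes pos: "\<forall>i\<le>\<alpha>. \<nu> i > 0"
begin

abbreviation "M \<equiv> msize \<nu> \<alpha>"
abbreviation "r \<equiv> rind \<nu> \<alpha>"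

lemma block_of:
  assumes "j < M"
  obtains i t where "i \<le> \<alpha>" "t < \<nu> i" "j = mseq \<nu> i + t" "r j = i"
  using block_cases[of j \<nu> \<alpha>] assms rind_block(2)[of _ \<alpha> _ \<nu>] by (auto simp: msize_def)

lemma msize_pos: "0 < M"
proof -
  have "mseq \<nu> 1 \<le> M" unfolding msize_def by (rule mseq_mono) simp
  moreover have "0 < \<nu> 0" using pos by simp
  ultimately show ?thesis by simp
qed

lemma rind_0: "r 0 = 0"
  using rind_block(2)[of 0 \<alpha> 0 \<nu>] pos by simp

lemma rind_Suc:
  assumes "j < M"
  shows "r (Suc j) = (if outer \<nu> \<alpha> j then Suc (r j) else r j)"
    and "outer \<nu> \<alpha> j \<Longrightarrow> mseq \<nu> (Suc (r j)) = Suc j"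
    and "\<not> outer \<nu> \<alpha> j \<Longrightarrow> Suc j < M"
    and "mseq \<nu> (r j) \<le> j"
proof -
  obtain i t where it: "i \<le> \<alpha>" "t < \<nu> i" "j = mseq \<nu> i + t" "r j = i"
    using block_of[OF assms] .
  show "mseq \<nu> (r j) \<le> j" using it by simp
  have out: "outer \<nu> \<alpha> j \<longleftrightarrow> Suc t = \<nu> i" using it by (auto simp: outer_def)
  show 2: "outer \<nu> \<alpha> j \<Longrightarrow> mseq \<nu> (Suc (r j)) = Suc j" by (simp add: outer_def)
  have "r (Suc j) = Suc i" if "outer \<nu> \<alpha> j"
  proof (cases "i = \<alpha>")
    case True
    then show ?thesis using 2[OF that] it rind_last[of \<nu> \<alpha>] by (simp add: msize_def)
  next
    case False
    then show ?thesis using 2[OF that] it pos rind_block(2)[of "Suc i" \<alpha> 0 \<nu>] by simp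
  qed
  moreover have "r (Suc j) = i" "Suc j < M" if "\<not> outer \<nu> \<alpha> j"
    using rind_block[of i \<alpha> "Suc t" \<nu>] it that out by auto
  ultimately show "r (Suc j) = (if outer \<nu> \<alpha> j then Suc (r j) else r j)"
    "\<not> outer \<nu> \<alpha> j \<Longrightarrow> Suc j < M"
    using it by auto
qed

text \<open>
  The pair \<open>(y\<^bsub>r(j)\<^esub>, n\<^sub>j)\<close> is a forward row vector in the sense of \<open>functional_invariant\<close>. It starts from
  \<open>(1, 0)\<close> and ends at \<open>(y\<^sub>\<alpha>\<^sub>+\<^sub>1, y\<^sub>\<alpha>)\<close>.
\<close>

lemma nseq_Suc:
  assumes "j < M"
  shows "yseq \<nu> (int (r (Suc j))) = (if outer \<nu> \<alpha> j then nseq \<nu> \<alpha> j + yseq \<nu> (int (r j)) else yseq \<nu> (int (r j)))"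
    and "nseq \<nu> \<alpha> (Suc j) = (if outer \<nu> \<alpha> j then yseq \<nu> (int (r j)) else nseq \<nu> \<alpha> j + yseq \<nu> (int (r j)))"
proof -
  note s = rind_Suc[OF assms]
  have "yseq \<nu> (int (Suc (r j))) = nseq \<nu> \<alpha> j + yseq \<nu> (int (r j))" if "outer \<nu> \<alpha> j"
  proof -
    have "\<nu> (r j) = Suc (j - mseq \<nu> (r j))" using s(2)[OF that] s(4) by simp
    then show ?thesis using yseq_step[of \<nu> "r j"] by (simp add: nseq_def Let_def add.commute)
  qed
  then show "yseq \<nu> (int (r (Suc j))) = (if outer \<nu> \<alpha> j then nseq \<nu> \<alpha> j + yseq \<nu> (int (r j)) else yseq \<nu> (int (r j)))"
    using s(1) by simp
  show "nseq \<nu> \<alpha> (Suc j) = (if outer \<nu> \<alpha> j then yseq \<nu> (int (r j)) else nseq \<nu> \<alpha> j + yseq \<nu> (int (r j)))"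
    using s by (simp add: nseq_def Let_def Suc_diff_le del: mseq.simps)
qed

text \<open>
  \<open>zlead\<close> and \<open>zindex\<close> are for \<open>z\<close> what \<open>y\<^bsub>r(j)\<^esub>\<close> and \<open>n\<^sub>j\<close> are for \<open>y\<close>, with start value \<open>(0, 1)\<close>. The
  first block has to be singled out since it would need \<open>z\<^sub>-\<^sub>2 = 1\<close>, whereas \<open>zseq\<close> is 0 at negative indices.
\<close>

definition zlead :: "nat \<Rightarrow> nat" where
  "zlead j = (if r j = 0 then 0 else zseq \<nu> (int (r j) - 1))"

definition zindex :: "nat \<Rightarrow> nat" where
  "zindex j = (if r j = 0 then 1
     else zseq \<nu> (int (r j) - 2) + (j - mseq \<nu> (r j)) * zseq \<nu> (int (r j) - 1))"

lemma zindex_Suc: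
  assumes "j < M"
  shows "zlead (Suc j) = (if outer \<nu> \<alpha> j then zindex j + zlead j else zlead j)"
    and "zindex (Suc j) = (if outer \<nu> \<alpha> j then zlead j else zindex j + zlead j)"
proof -
  note s = rind_Suc[OF assms]
  have "zlead (Suc j) = zindex j + zlead j" if o: "outer \<nu> \<alpha> j"
  proof (cases "r j")
    case 0
    then show ?thesis using s(1) o by (simp add: zlead_def zindex_def)
  next
    case (Suc i)
    have "\<nu> (r j) = Suc (j - mseq \<nu> (r j))" using s(2)[OF o] s(4) by simp
    then show ?thesis using zseq_step[of \<nu> i] s(1) o Suc
      by (simp add: zlead_def zindex_def add.commute)
  qed
  then show "zlead (Suc j) = (if outer \<nu> \<alpha> j then zindex j + zlead j else zlead j)"
    using s(1) by (simp add: zlead_def)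
  show "zindex (Suc j) = (if outer \<nu> \<alpha> j then zlead j else zindex j + zlead j)"
    using s by (auto simp: zlead_def zindex_def Suc_diff_le zseq.simps[of \<nu> "-1"] simp del: mseq.simps)
qed

lemma cf_word_Cons: "j < M \<Longrightarrow> cf_word \<nu> \<alpha> j = outer \<nu> \<alpha> j # cf_word \<nu> \<alpha> (Suc j)"
  by (simp add: cf_word_def upt_conv_Cons)

lemma cf_word_end: "cf_word \<nu> \<alpha> M = []"
  by (simp add: cf_word_def)

abbreviation cpair :: "nat \<Rightarrow> nat \<Rightarrow> nat \<Rightarrow> nat \<times> nat" where
  "cpair k m j \<equiv> coord (cf_word \<nu> \<alpha> j) k m"

lemma cpair_step:
  assumes "j < M"
  shows "fst (cpair k m j) = fst (cpair k m (Suc j)) + snd (cpair k m (Suc j))"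
    and "snd (cpair k m j) = (if outer \<nu> \<alpha> j then fst (cpair k m (Suc j)) else snd (cpair k m (Suc j)))"
  using assms by (simp_all add: cf_word_Cons case_prod_beta)

text \<open>
  The bosonic side of the translation: the lower indices of the kernel are the two linear forms in \<open>(k, m)\<close> whose
  product is the exponent of \<open>q\<close> on the right-hand side.
\<close>

lemma coord_cf_word:
  "coord (cf_word \<nu> \<alpha> 0) k m =
     (k * yseq \<nu> (int \<alpha> + 1) + m * yseq \<nu> (int \<alpha>), k * zseq \<nu> (int \<alpha>) + m * zseq \<nu> (int \<alpha> - 1))"
proof -
  have n: "nseq \<nu> \<alpha> M = yseq \<nu> (int \<alpha>)"
    by (simp add: nseq_def Let_def rind_last) (simp add: msize_def)
  have z: "zlead M = zseq \<nu> (int \<alpha>)" "zindex M = zseq \<nu> (int \<alpha> - 1)"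
    by (simp_all add: zlead_def zindex_def rind_last) (simp add: msize_def)
  have 1: "nseq \<nu> \<alpha> 0 = 0" "zlead 0 = 0" "zindex 0 = 1"
    by (simp_all add: nseq_def zlead_def zindex_def rind_0)
  have "yseq \<nu> (int (r 0)) * fst (cpair k m 0) + nseq \<nu> \<alpha> 0 * snd (cpair k m 0)
      = yseq \<nu> (int (r M)) * fst (cpair k m M) + nseq \<nu> \<alpha> M * snd (cpair k m M)
        + (\<Sum>j = 0..<M. nseq \<nu> \<alpha> j * 0)"
    by (rule functional_invariant[where T = "outer \<nu> \<alpha>"]) (simp_all add: nseq_Suc cpair_step)
  moreover have "zlead 0 * fst (cpair k m 0) + zindex 0 * snd (cpair k m 0)
      = zlead M * fst (cpair k m M) + zindex M * snd (cpair k m M) + (\<Sum>j = 0..<M. zindex j * 0)"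
    by (rule functional_invariant[where T = "outer \<nu> \<alpha>"]) (simp_all add: zindex_Suc cpair_step)
  ultimately show ?thesis
    by (simp add: prod_eq_iff 1 n z rind_0 rind_last cf_word_end mult.commute add.commute)
qed

lemma eps_Suc: "j < M \<Longrightarrow> eps \<nu> \<alpha> (Suc j) = (if outer \<nu> \<alpha> j then - eps \<nu> \<alpha> j else eps \<nu> \<alpha> j)"
  by (simp add: eps_def rind_Suc)

lemma eps_0: "eps \<nu> \<alpha> 0 = 1"
  by (simp add: eps_def rind_0)

lemma eps_end: "eps \<nu> \<alpha> M = (-1) ^ Suc \<alpha>"
  by (simp add: eps_def rind_last)

definition tail_of :: "(nat \<Rightarrow> nat) \<Rightarrow> nat \<Rightarrow> nat list" where
  "tail_of lam j = map lam [j..<Suc M]"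

abbreviation spair :: "(nat \<Rightarrow> nat) \<Rightarrow> nat \<Rightarrow> nat \<times> nat" where
  "spair lam j \<equiv> state (cf_word \<nu> \<alpha> j) (tail_of lam j)"

lemma tail_of_Cons: "j \<le> M \<Longrightarrow> tail_of lam j = lam j # tail_of lam (Suc j)"
  unfolding tail_of_def by (subst upt_conv_Cons) auto

lemma spair_step:
  assumes "j < M"
  shows "fst (spair lam j) = fst (spair lam (Suc j)) + snd (spair lam (Suc j))"
    and "snd (spair lam j) = (if outer \<nu> \<alpha> j then fst (spair lam (Suc j)) else snd (spair lam (Suc j))) + lam j"
  using assms by (simp_all add: cf_word_Cons tail_of_Cons case_prod_beta)

lemma spair_end: "spair lam M = (0, lam M)"
  by (simp add: cf_word_end tail_of_Cons)

text \<open>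
  The constraint \<open>\<Sum>\<^sub>j n\<^sub>j \<lambda>\<^sub>j = l\<close> in the definition of \<open>V\<^sub>l\<close> fixes the sum of the two indices of the chain after its
  first step.
\<close>

lemma spair_total: "fst (spair lam 1) + snd (spair lam 1) = (\<Sum>j = 1..M. nseq \<nu> \<alpha> j * lam j)"
proof -
  have 1: "nseq \<nu> \<alpha> 1 = 1" "yseq \<nu> (int (r 1)) = 1"
    using nseq_Suc[OF msize_pos] by (simp_all add: nseq_def rind_0)
  have "yseq \<nu> (int (r 1)) * fst (spair lam 1) + nseq \<nu> \<alpha> 1 * snd (spair lam 1)
      = yseq \<nu> (int (r M)) * fst (spair lam M) + nseq \<nu> \<alpha> M * snd (spair lam M)
        + (\<Sum>j = 1..<M. nseq \<nu> \<alpha> j * lam j)"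
    using msize_pos by (intro functional_invariant[where T = "outer \<nu> \<alpha>"]) (simp_all add: nseq_Suc spair_step)
  also have "\<dots> = (\<Sum>j = 1..<Suc M. nseq \<nu> \<alpha> j * lam j)"
    using msize_pos by (simp add: spair_end)
  finally show ?thesis unfolding 1 by (simp add: atLeastLessThanSuc_atLeastAtMost)
qed

lemma energy_sum:
  "j \<le> M \<Longrightarrow> eps \<nu> \<alpha> j * energy (cf_word \<nu> \<alpha> j) (tail_of lam j)
     = - (\<Sum>i = j..M. eps \<nu> \<alpha> i * int (fst (spair lam i) * lam i))"
proof (induction j rule: inc_induct)
  case base
  show ?case by (simp add: cf_word_end spair_end)
next
  case (step j)
  have e: "energy (cf_word \<nu> \<alpha> j) (tail_of lam j)
     = (if outer \<nu> \<alpha> j then - energy (cf_word \<nu> \<alpha> (Suc j)) (tail_of lam (Suc j))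
        else energy (cf_word \<nu> \<alpha> (Suc j)) (tail_of lam (Suc j))) - int (fst (spair lam j) * lam j)"
    using step(2) by (simp add: cf_word_Cons tail_of_Cons)
  show ?case using step unfolding e
    by (auto simp: eps_Suc sum.atLeast_Suc_atMost[of j] algebra_simps simp del: of_nat_mult split: if_splits)
qed

lemma powi_eps_Suc:
  "j < M \<Longrightarrow> q powi eps \<nu> \<alpha> (Suc j)
     = (if outer \<nu> \<alpha> j then inverse (q powi eps \<nu> \<alpha> j) else q powi eps \<nu> \<alpha> j)"
  for q :: "'a :: field"
  by (simp add: eps_Suc power_int_minus)

lemma weight_prod:
  fixes q :: "'a :: field"
  shows "j \<le> M \<Longrightarrow> weight (q powi eps \<nu> \<alpha> j) (cf_word \<nu> \<alpha> j) (tail_of lam j)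
     = (\<Prod>i = j..M. qfact (q powi eps \<nu> \<alpha> i) (lam i))"
proof (induction j rule: inc_induct)
  case base
  show ?case by (simp add: cf_word_end tail_of_Cons)
next
  case (step j)
  then show ?case
    by (simp add: cf_word_Cons tail_of_Cons prod.atLeast_Suc_atMost[of j] powi_eps_Suc)
qed

lemma end_base_cf_word:
  fixes q :: "'a :: field"
  shows "j \<le> M \<Longrightarrow> end_base (q powi eps \<nu> \<alpha> j) (cf_word \<nu> \<alpha> j) = q powi eps \<nu> \<alpha> M"
proof (induction j rule: inc_induct)
  case base
  show ?case by (simp add: cf_word_end)
next
  case (step j)
  then show ?case by (simp add: cf_word_Cons powi_eps_Suc)
qed

text \<open>
  Let \<open>(A\<^sub>j, B\<^sub>j)\<close> be the pairs of indices and \<open>(P\<^sub>j, R\<^sub>j)\<close> the solution of the same recursion with \<open>\<lambda> = 0\<close> that ends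
  at \<open>(1, 0)\<close>, so that \<open>P\<^sub>0 = y\<^sub>\<alpha>\<^sub>+\<^sub>1\<close> and \<open>R\<^sub>0 = z\<^sub>\<alpha>\<close>. The recursion says that \<open>-A\<close> satisfies the rows of
  \<open>\<Theta>\<^sup>-\<^sup>1 x = (\<epsilon>(j) \<lambda>\<^sub>j)\<close> when \<open>x\<^sub>0\<close> is included as an extra unknown, but \<open>-A\<^sub>0 = -l\<close> is not 0. Since \<open>P\<close> solves the
  homogeneous rows, \<open>-A + (l/y\<^sub>\<alpha>\<^sub>+\<^sub>1) P\<close> is the true solution. The contribution of \<open>P\<close> to the quadratic form telescopes
  by means of the Wronskian \<open>A\<^sub>j R\<^sub>j - B\<^sub>j P\<^sub>j\<close>, with boundary value
  \<open>y\<^sub>\<alpha>\<^sub>+\<^sub>1 B\<^sub>0 - l z\<^sub>\<alpha>\<close>; this is where \<open>l\<^sup>2/p\<^sub>0 = l\<^sup>2 z\<^sub>\<alpha> / y\<^sub>\<alpha>\<^sub>+\<^sub>1\<close> comes from. The condition \<open>\<lambda>\<^sub>0 = 0\<close> turns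
  the letter for \<open>j = 0\<close> into a step without summation variable.
\<close>

lemma quadratic_form:
  assumes lam0: "lam 0 = 0" and l: "l = fst (spair lam 0)"
  shows "1 / 2 * (lam_tilde \<nu> \<alpha> lam \<bullet> (Bmat \<nu> \<alpha> *\<^sub>v lam_tilde \<nu> \<alpha> lam))
     + of_nat l ^ 2 * of_nat (zseq \<nu> (int \<alpha>)) / of_nat (yseq \<nu> (int \<alpha> + 1))
    = of_nat l * of_nat (snd (spair lam 0))
      - (\<Sum>j = 1..M. of_int (eps \<nu> \<alpha> j) * of_nat (fst (spair lam j) * lam j))"
proof -
  let ?y = "of_nat (yseq \<nu> (int \<alpha> + 1)) :: rat" and ?z = "of_nat (zseq \<nu> (int \<alpha>)) :: rat"
  let ?lt = "lam_tilde \<nu> \<alpha> lam"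
  let ?e = "\<lambda>j. of_int (eps \<nu> \<alpha> j) :: rat"
  define c where "c = of_nat l / ?y"
  define A where "A j = (of_nat (fst (spair lam j)) :: rat)" for j
  define B where "B j = (of_nat (snd (spair lam j)) :: rat)" for j
  define P where "P j = (of_nat (fst (cpair 1 0 j)) :: rat)" for j
  define R where "R j = (of_nat (snd (cpair 1 0 j)) :: rat)" for j
  have y: "?y \<noteq> 0" using yseq_pos[of "\<alpha> + 1" \<nu>] pos by (auto simp: algebra_simps)
  have step: "A j = A (Suc j) + B (Suc j)" "P j = P (Suc j) + R (Suc j)"
    "B j = (if outer \<nu> \<alpha> j then A (Suc j) else B (Suc j)) + of_nat (lam j)"
    "R j = (if outer \<nu> \<alpha> j then P (Suc j) else R (Suc j))"
    "?e (Suc j) = (if outer \<nu> \<alpha> j then - ?e j else ?e j)" if "j < M" for j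
    using that unfolding A_def B_def P_def R_def
    by (simp_all add: spair_step cpair_step eps_Suc)
  have fin: "A M = 0" "B M = of_nat (lam M)" "P M = 1" "R M = 0"
    by (simp_all add: A_def B_def P_def R_def spair_end cf_word_end tail_of_Cons)
  have ini: "A 0 = of_nat l" "P 0 = ?y" "R 0 = ?z"
    by (simp_all add: A_def P_def R_def l coord_cf_word)
  \<comment> \<open>The definition of \<open>c\<close> makes \<open>x\<^sub>0 = -A\<^sub>0 + c P\<^sub>0\<close> vanish.\<close>
  define v where "v = vec M (\<lambda>i. - A (Suc i) + c * P (Suc i))"
  define x where "x j = (if 1 \<le> j \<and> j \<le> M then v $ (j - 1) else 0)" for j
  have x: "x j = - A j + c * P j" if "j \<le> M" for j
  proof (cases j)
    case 0
    then show ?thesis using y by (simp add: x_def ini c_def)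
  qed (use that in \<open>simp add: x_def v_def\<close>)
  have v: "v \<in> carrier_vec M" by (simp add: v_def)
  have eps_pow: "(-1) ^ r j = ?e j" for j by (simp add: eps_def)
  \<comment> \<open>The difference \<open>x\<^sub>j - x\<^bsub>j-1\<^esub>\<close> is \<open>B\<^sub>j - c R\<^sub>j\<close>, whatever the letter at \<open>j - 1\<close>.\<close>
  have row: "(Theta_inv \<nu> \<alpha> *\<^sub>v v) $ (j - 1) = ?e j * of_nat (lam j)" if j: "1 \<le> j" "j \<le> M" for j
  proof -
    obtain i where i: "j = Suc i" using j by (cases j) auto
    have d: "x j - x i = B j - c * R j" using step(1,2)[of i] x[of j] x[of i] j i by (simp add: algebra_simps)
    have 1: "(Theta_inv \<nu> \<alpha> *\<^sub>v v) $ (j - 1) =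
        cdiag \<nu> \<alpha> j * x j - ?e (Suc j) * x (Suc j) - ?e j * x i"
      using Theta_inv_mult_vec[OF v j x_def] unfolding eps_pow i by simp
    show ?thesis
    proof (cases "j = M")
      case True
      have "cdiag \<nu> \<alpha> j = ?e j" by (simp add: cdiag_def True eps_def rind_last)
      moreover have "x (Suc j) = 0" by (simp add: x_def True)
      ultimately show ?thesis using d unfolding 1 by (simp add: True fin algebra_simps)
    next
      case False
      then have jM: "j < M" using j by simp
      have cd: "cdiag \<nu> \<alpha> j = (if outer \<nu> \<alpha> j then ?e j else 2 * ?e j)"
        using False by (simp add: cdiag_def outer_def eps_def)
      have d': "x (Suc j) - x j = B (Suc j) - c * R (Suc j)"
        using step(1,2)[OF jM] x[of j] x[of "Suc j"] jM by (simp add: algebra_simps)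
      show ?thesis
      proof (cases "outer \<nu> \<alpha> j")
        case True
        have "(Theta_inv \<nu> \<alpha> *\<^sub>v v) $ (j - 1) = ?e j * ((x j - x i) + x (Suc j))"
          unfolding 1 cd step(5)[OF jM] using True by (simp add: algebra_simps)
        also have "(x j - x i) + x (Suc j) = of_nat (lam j)"
          unfolding d using x[of "Suc j"] step(3,4)[OF jM] True jM by (simp add: algebra_simps)
        finally show ?thesis .
      next
        case False
        have "(Theta_inv \<nu> \<alpha> *\<^sub>v v) $ (j - 1) = ?e j * ((x j - x i) - (x (Suc j) - x j))"
          unfolding 1 cd step(5)[OF jM] using False by (simp add: algebra_simps)
        also have "(x j - x i) - (x (Suc j) - x j) = of_nat (lam j)"
          unfolding d d' using step(3,4)[OF jM] False by (simp add: algebra_simps)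
        finally show ?thesis .
      qed
    qed
  qed
  note T = Theta_inverse[OF pos]
  have TA: "Theta_inv \<nu> \<alpha> \<in> carrier_mat M M" by (simp add: Theta_inv_def)
  have "Theta_inv \<nu> \<alpha> *\<^sub>v v = ?lt"
  proof (rule eq_vecI)
    fix i assume "i < dim_vec ?lt"
    then show "(Theta_inv \<nu> \<alpha> *\<^sub>v v) $ i = ?lt $ i"
      using row[of "Suc i"] by (simp add: lam_tilde_def)
  qed (use TA in \<open>simp add: lam_tilde_def\<close>)
  then have Tl: "Theta \<nu> \<alpha> *\<^sub>v ?lt = v"
    using assoc_mult_mat_vec[OF T(3) TA v] T(2) v by simp
  have lt: "?lt \<in> carrier_vec M" by (simp add: lam_tilde_def)
  have "Bmat \<nu> \<alpha> *\<^sub>v ?lt = 2 \<cdot>\<^sub>v v"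
    unfolding Tl[symmetric] using T(3) lt
    by (intro eq_vecI) (auto simp: Bmat_def scalar_prod_def sum_distrib_left mult.assoc)
  then have "1 / 2 * (?lt \<bullet> (Bmat \<nu> \<alpha> *\<^sub>v ?lt)) = ?lt \<bullet> v"
    using v lt by simp
  also have "\<dots> = (\<Sum>i = 0..<M. ?e (Suc i) * of_nat (lam (Suc i)) * (- A (Suc i) + c * P (Suc i)))"
    by (simp add: scalar_prod_def v_def lam_tilde_def)
  also have "\<dots> = (\<Sum>j = 1..M. ?e j * of_nat (lam j) * (- A j + c * P j))"
    by (rule sum.reindex_bij_witness[of _ "\<lambda>j. j - 1" Suc]) auto
  also have "\<dots> = c * (\<Sum>j = 1..M. ?e j * of_nat (lam j) * P j) - (\<Sum>j = 1..M. ?e j * (A j * of_nat (lam j)))"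
    by (simp add: sum_distrib_left sum_subtractf[symmetric] algebra_simps)
  finally have form: "1 / 2 * (?lt \<bullet> (Bmat \<nu> \<alpha> *\<^sub>v ?lt))
      = c * (\<Sum>j = 1..M. ?e j * of_nat (lam j) * P j) - (\<Sum>j = 1..M. ?e j * (A j * of_nat (lam j)))" .
  \<comment> \<open>The Wronskian of the two solutions.\<close>
  define W where "W j = ?e j * (A j * R j - B j * P j)" for j
  have W: "?e j * of_nat (lam j) * P j = W (Suc j) - W j" if "j < M" for j
    unfolding W_def step[OF that] by (simp add: algebra_simps)
  have "(\<Sum>j = 0..M. ?e j * of_nat (lam j) * P j)
      = (\<Sum>j = 0..<M. W (Suc j) - W j) + ?e M * of_nat (lam M) * P M"
    using W by (simp add: atLeastLessThanSuc_atLeastAtMost[symmetric])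
  also have "\<dots> = - W 0"
    by (subst sum_Suc_diff') (simp_all add: W_def fin)
  finally have "(\<Sum>j = 0..M. ?e j * of_nat (lam j) * P j) = ?y * B 0 - of_nat l * ?z"
    by (simp add: W_def ini eps_0 mult.commute)
  then have S: "(\<Sum>j = 1..M. ?e j * of_nat (lam j) * P j) = ?y * B 0 - of_nat l * ?z"
    by (simp add: sum.atLeast_Suc_atMost[of 0] lam0)
  have "c * (\<Sum>j = 1..M. ?e j * of_nat (lam j) * P j) = of_nat l * B 0 - of_nat l ^ 2 * ?z / ?y"
    unfolding S using y by (simp add: c_def field_simps power2_eq_square)
  then show ?thesis unfolding form by (simp add: A_def B_def)
qed

end

section \<open>Summation of formal Laurent series\<close>

definition fls_order_ge :: "int \<Rightarrow> 'a :: field fls \<Rightarrow> bool" where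
  "fls_order_ge n f \<longleftrightarrow> f = 0 \<or> n \<le> fls_subdegree f"

lemma fls_order_ge_nth: "fls_order_ge n f \<Longrightarrow> i < n \<Longrightarrow> fls_nth f i = 0"
  by (auto simp: fls_order_ge_def)

lemma fls_order_ge_mult:
  "fls_order_ge a f \<Longrightarrow> fls_order_ge b g \<Longrightarrow> fls_order_ge (a + b) (f * g)"
  unfolding fls_order_ge_def by (cases "f = 0"; cases "g = 0") auto

lemma fls_order_ge_add:
  "fls_order_ge a f \<Longrightarrow> fls_order_ge a g \<Longrightarrow> fls_order_ge a (f + g)"
  unfolding fls_order_ge_def using fls_plus_subdegree[of f g] by fastforce

lemma fls_order_ge_mono: "fls_order_ge a f \<Longrightarrow> b \<le> a \<Longrightarrow> fls_order_ge b f"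
  by (auto simp: fls_order_ge_def)

text \<open>
  In the \<open>t\<close>-adic metric a family is summable as soon as every initial segment of coefficients is affected by finitely many
  members only; the sum is then computed coefficientwise.
\<close>

lemma fls_has_sumI:
  fixes f :: "'b \<Rightarrow> 'a :: field fls"
  assumes fin: "\<And>n. finite {x \<in> A. \<exists>i\<le>n. fls_nth (f x) i \<noteq> 0}"
    and s: "\<And>i. fls_nth s i = (\<Sum>x | x \<in> A \<and> fls_nth (f x) i \<noteq> 0. fls_nth (f x) i)"
  shows "(f has_sum s) A"
  unfolding has_sum_def tendsto_iff
proof (intro allI impI)
  fix e :: real assume "e > 0"
  then obtain n where n: "inverse (2 ^ n) < e"
    using real_arch_pow_inv[of e "1 / 2"] by (auto simp: power_one_over field_simps)
  let ?F = "{x \<in> A. \<exists>i\<le>int n. fls_nth (f x) i \<noteq> 0}"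
  have "dist (sum f X) s < e" if X: "finite X" "?F \<subseteq> X" "X \<subseteq> A" for X
  proof (cases "sum f X = s")
    case False
    have nth: "fls_nth (sum f X - s) i = 0" if "i \<le> int n" for i
    proof -
      have "fls_nth (sum f X) i = (\<Sum>x\<in>X. fls_nth (f x) i)"
        by (rule fls_nth_sum)
      also have "\<dots> = fls_nth s i"
        unfolding s using X that by (intro sum.mono_neutral_right) auto
      finally show ?thesis by simp
    qed
    have "int n < fls_subdegree (sum f X - s)"
    proof (rule ccontr)
      assume "\<not> ?thesis"
      then show False using nth[of "fls_subdegree (sum f X - s)"] False
          nth_fls_subdegree_nonzero[of "sum f X - s"] by (simp del: fls_minus_nth)
    qed
    then have "dist (sum f X) s \<le> inverse (2 ^ n)"
      using False by (auto simp: dist_fls_def intro!: power_increasing)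
    then show ?thesis using n by simp
  qed (use \<open>e > 0\<close> in simp)
  then show "\<forall>\<^sub>F X in finite_subsets_at_top A. dist (sum f X) s < e"
    unfolding eventually_finite_subsets_at_top using fin[of "int n"]
    by (intro exI[of _ ?F]) auto
qed

lemma fls_coefficient_sum_exists:
  fixes f :: "'b \<Rightarrow> 'a :: field fls"
  assumes "\<And>x. x \<in> A \<Longrightarrow> fls_order_ge 0 (f x)"
  shows "\<exists>s. \<forall>i. fls_nth s i = (\<Sum>x | x \<in> A \<and> fls_nth (f x) i \<noteq> 0. fls_nth (f x) i)"
proof -
  let ?c = "\<lambda>i. \<Sum>x | x \<in> A \<and> fls_nth (f x) i \<noteq> 0. fls_nth (f x) i"
  have "?c i = 0" if "i < 0" for i
    using that fls_order_ge_nth[OF assms] by (intro sum.neutral) auto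
  then have "fls_nth (Abs_fls ?c) i = ?c i" for i
    by (intro nth_Abs_fls_lower_bound[of 0]) auto
  then show ?thesis by blast
qed

text \<open>
  Such a family may be summed in groups, because each coefficient of the total is a finite sum.
\<close>

lemma fls_has_sum_fibres:
  fixes f :: "'b \<Rightarrow> 'a :: field fls"
  assumes fin: "\<And>n. finite {x \<in> A. \<exists>i\<le>n. fls_nth (f x) i \<noteq> 0}"
    and fib: "\<And>l. finite {x \<in> A. g x = l}"
    and s: "\<And>i. fls_nth s i = (\<Sum>x | x \<in> A \<and> fls_nth (f x) i \<noteq> 0. fls_nth (f x) i)"
  shows "((\<lambda>l. \<Sum>x | x \<in> A \<and> g x = l. f x) has_sum s) UNIV"
proof (rule fls_has_sumI)
  let ?h = "\<lambda>l. \<Sum>x | x \<in> A \<and> g x = l. f x"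
  have h: "fls_nth (?h l) i = (\<Sum>x | x \<in> A \<and> g x = l. fls_nth (f x) i)" for l i
    by (rule fls_nth_sum)
  have sub: "l \<in> g ` {x \<in> A. fls_nth (f x) i \<noteq> 0}" if "fls_nth (?h l) i \<noteq> 0" for l i
  proof (rule ccontr)
    assume "l \<notin> g ` {x \<in> A. fls_nth (f x) i \<noteq> 0}"
    then have "fls_nth (?h l) i = 0" unfolding h by (intro sum.neutral) auto
    then show False using that by simp
  qed
  show "finite {l \<in> UNIV. \<exists>i\<le>n. fls_nth (?h l) i \<noteq> 0}" for n
    using sub by (intro finite_subset[OF _ finite_imageI[OF fin[of n], of g]]) fastforce
  show "fls_nth s i = (\<Sum>l | l \<in> UNIV \<and> fls_nth (?h l) i \<noteq> 0. fls_nth (?h l) i)" for i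
  proof -
    let ?S = "{x \<in> A. fls_nth (f x) i \<noteq> 0}"
    have S: "finite ?S" by (rule finite_subset[OF _ fin[of i]]) auto
    have "fls_nth s i = (\<Sum>l\<in>g ` ?S. \<Sum>x | x \<in> ?S \<and> g x = l. fls_nth (f x) i)"
      unfolding s using sum.image_gen[OF S] by simp
    also have "\<dots> = (\<Sum>l\<in>g ` ?S. fls_nth (?h l) i)"
      unfolding h by (intro sum.cong refl sum.mono_neutral_left fib) auto
    also have "\<dots> = (\<Sum>l | l \<in> UNIV \<and> fls_nth (?h l) i \<noteq> 0. fls_nth (?h l) i)"
      using sub S by (intro sum.mono_neutral_right) auto
    finally show ?thesis .
  qed
qed

section \<open>The identity for each degree\<close>

lemma fls_X_intpow_powi: "(fls_X_intpow i :: 'a :: field fls) powi n = fls_X_intpow (i * n)"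
  by (simp add: power_int_mult flip: fls_X_power_int)

lemma generic_fls_X_intpow:
  assumes "y > 0"
  shows "generic (fls_X_intpow (int y) :: 'a :: field fls)"
proof -
  have "(fls_X_intpow (int y) :: 'a fls) ^ n \<noteq> 1" if "n > 0" for n
  proof
    assume "(fls_X_intpow (int y) :: 'a fls) ^ n = 1"
    then have "fls_subdegree (fls_X_intpow (int n * int y) :: 'a fls) = 0"
      by (simp only: fls_X_intpow_power) simp
    then show False using that assms by simp
  qed
  then show ?thesis by (simp add: generic_def)
qed

lemma fls_subdegree_qfact:
  assumes "y > 0"
  shows "fls_subdegree (qfact (fls_X_intpow (int y) :: 'a :: field fls) n) = 0"
proof (induction n)
  case (Suc n)
  let ?q = "fls_X_intpow (int y) :: 'a fls"
  have nz: "qfact ?q n \<noteq> 0" "1 - ?q ^ Suc n \<noteq> 0"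
    using qfact_nonzero[OF generic_fls_X_intpow[OF assms]]
      generic_power[OF generic_fls_X_intpow[OF assms], of "Suc n"] by auto
  have "0 < int (Suc n) * int y" using assms by simp
  then have "fls_subdegree (1 - ?q ^ Suc n) = 0"
    unfolding fls_X_intpow_power by (subst fls_subdegree_diff_eq1) auto
  then show ?case using nz Suc unfolding qfact_Suc by (subst fls_subdegree_mult) auto
qed simp

lemma fls_order_ge_divide_qfact:
  fixes f :: "'a :: field fls"
  assumes "fls_order_ge n f" "y > 0"
  shows "fls_order_ge n (f / qfact (fls_X_intpow (int y)) k)"
proof -
  let ?d = "qfact (fls_X_intpow (int y) :: 'a fls) k"
  have "fls_subdegree (inverse ?d) = - fls_subdegree ?d" by (rule fls_inverse_subdegree)
  then have "fls_order_ge 0 (inverse ?d)"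
    unfolding fls_order_ge_def fls_subdegree_qfact[OF assms(2)] by simp
  then show ?thesis using fls_order_ge_mult[OF assms(1)] by (fastforce simp: divide_inverse)
qed

lemma fls_order_ge_gauss:
  assumes "y > 0"
  shows "fls_order_ge 0 (gauss (fls_X_intpow (int y) :: 'a :: field fls) n k)"
proof -
  have "fls_order_ge 0 (qfact (fls_X_intpow (int y) :: 'a fls) n)"
    unfolding fls_order_ge_def fls_subdegree_qfact[OF assms] by simp
  from fls_order_ge_divide_qfact[OF fls_order_ge_divide_qfact[OF this assms, of k] assms, of "n - k"]
  show ?thesis by (simp add: gauss_def) (simp add: fls_order_ge_def)
qed

lemma fls_order_ge_powi:
  assumes "n \<le> int y * i"
  shows "fls_order_ge n ((fls_X_intpow (int y) :: 'a :: field fls) powi i)"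
  unfolding fls_X_intpow_powi using assms by (simp add: fls_order_ge_def)

lemma fls_order_ge_Qpoly:
  assumes "y > 0" "k > 0" "m \<le> k" "s = 1 \<or> s = -1"
  shows "fls_order_ge 0 (Qpoly s (fls_X_intpow (int y) :: 'a :: field fls) k m)"
proof -
  have "fls_order_ge (0 + 0) ((fls_X_intpow (int y) :: 'a fls) powi ((1 - s) div 2 * (int k + int m))
      * gauss (fls_X_intpow (int y)) (k - 1) m)"
    using assms by (intro fls_order_ge_mult fls_order_ge_powi fls_order_ge_gauss) auto
  moreover have "fls_order_ge 0 (if m = 0 then 0 else gauss (fls_X_intpow (int y) :: 'a fls) (k - 1) (m - 1))"
    using assms fls_order_ge_gauss[of y "k - 1" "m - 1"] by (auto simp: fls_order_ge_def)
  then have "fls_order_ge (0 + 0) ((fls_X_intpow (int y) :: 'a fls) powi ((1 + s) div 2 * (2 * int k - int m))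
      * (if m = 0 then 0 else gauss (fls_X_intpow (int y)) (k - 1) (m - 1)))"
    using assms by (intro fls_order_ge_mult fls_order_ge_powi) auto
  ultimately show ?thesis
    unfolding Qpoly_def qbinom_pred[OF assms(2)] by (intro fls_order_ge_add) simp_all
qed

lemma qpow_of_int:
  "qpow \<nu> \<alpha> (of_int n) = qpow \<nu> \<alpha> 1 powi n"
proof -
  have "(of_nat (yseq \<nu> (int \<alpha> + 1)) :: rat) * of_int n = of_int (int (yseq \<nu> (int \<alpha> + 1)) * n)"
    by simp
  then have "\<lfloor>(of_nat (yseq \<nu> (int \<alpha> + 1)) :: rat) * of_int n\<rfloor> = int (yseq \<nu> (int \<alpha> + 1)) * n"
    by (simp only: floor_of_int)
  then show ?thesis by (simp add: qpow_def fls_X_intpow_powi)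
qed

lemma qpow_mult:
  assumes "of_nat (yseq \<nu> (int \<alpha> + 1)) * a \<in> \<int>" "of_nat (yseq \<nu> (int \<alpha> + 1)) * b \<in> \<int>"
  shows "qpow \<nu> \<alpha> a * qpow \<nu> \<alpha> b = qpow \<nu> \<alpha> (a + b)"
proof -
  obtain i j where "of_nat (yseq \<nu> (int \<alpha> + 1)) * a = of_int i" "of_nat (yseq \<nu> (int \<alpha> + 1)) * b = of_int j"
    using assms by (metis Ints_cases)
  moreover from this have "of_nat (yseq \<nu> (int \<alpha> + 1)) * (a + b) = (of_int (i + j) :: rat)"
    by (simp add: distrib_left)
  ultimately show ?thesis by (simp only: qpow_def floor_of_int fls_X_intpow_times_fls_X_intpow)
qed

context continued_fraction
begin

text \<open>
  The summand of \<open>q\<^bsup>l\<^sup>2/p\<^sub>0\<^esup> V\<^sub>l\<close> that belongs to \<open>\<lambda>\<close> is the summand of the fermionic sum that belongs to the list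
  \<open>\<lambda>\<^sub>1, \<lambda>\<^sub>2, \<dots>\<close>. The exponents of \<open>l\<^sup>2/p\<^sub>0\<close> and of the quadratic form are fractional, but their sum is an integer.
\<close>

lemma Vser_term:
  assumes p0: "p0 = cfrac (map \<nu> [0..<\<alpha> + 1])"
    and lam: "lam \<in> lams \<nu> \<alpha> l"
  defines "q \<equiv> qpow \<nu> \<alpha> 1" and "w \<equiv> cf_word \<nu> \<alpha> 1" and "t \<equiv> outer \<nu> \<alpha> 0"
  defines "xs \<equiv> map lam [1..<Suc (msize \<nu> \<alpha>)]"
  shows "qpow \<nu> \<alpha> (of_nat l ^ 2 / p0) *
      (qpow \<nu> \<alpha> (1 / 2 * (lam_tilde \<nu> \<alpha> lam \<bullet> (Bmat \<nu> \<alpha> *\<^sub>v lam_tilde \<nu> \<alpha> lam)))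
        / (\<Prod>j = 1..msize \<nu> \<alpha>.
             qpoch (qpow \<nu> \<alpha> (of_int (eps \<nu> \<alpha> j))) (qpow \<nu> \<alpha> (of_int (eps \<nu> \<alpha> j))) (lam j)))
     = q powi (int l * int (if t then fst (state w xs) else snd (state w xs))
              + (if t then - energy w xs else energy w xs))
      / weight (if t then inverse q else q) w xs"
    and "fst (state w xs) + snd (state w xs) = l"
proof -
  let ?M = "msize \<nu> \<alpha>"
  \<comment> \<open>Functions in \<open>lams\<close> are undefined at 0, where the recursion of the indices needs the value 0.\<close>
  define lam' where "lam' = lam(0 := 0)"
  have M: "0 < ?M" by (rule msize_pos)
  have eq: "lam' j = lam j" if "j \<in> {1..?M}" for j using that by (simp add: lam'_def)
  have xs: "xs = tail_of lam' 1"
    unfolding xs_def tail_of_def by (rule map_cong) (auto simp: lam'_def)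
  have "fst (state w xs) + snd (state w xs) = (\<Sum>j = 1..?M. nseq \<nu> \<alpha> j * lam j)"
    unfolding xs w_def spair_total by (rule sum.cong) (simp_all only: eq)
  then show l: "fst (state w xs) + snd (state w xs) = l"
    using lam by (simp add: lams_def)
  have st0: "fst (state (cf_word \<nu> \<alpha> 0) (tail_of lam' 0)) = fst (state w xs) + snd (state w xs)"
    "snd (state (cf_word \<nu> \<alpha> 0) (tail_of lam' 0)) = (if t then fst (state w xs) else snd (state w xs)) + lam' 0"
    using spair_step[OF M, of lam'] unfolding w_def t_def xs by simp_all
  have lt: "lam_tilde \<nu> \<alpha> lam' = lam_tilde \<nu> \<alpha> lam"
    unfolding lam_tilde_def by (intro eq_vecI) (auto simp: lam'_def)
  have l0: "l = fst (state (cf_word \<nu> \<alpha> 0) (tail_of lam' 0))"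
    using st0 l by simp
  have e1: "eps \<nu> \<alpha> 1 = (if t then -1 else 1)"
    using eps_Suc[OF M] eps_0 by (simp add: t_def)
  have en: "(if t then - energy w xs else energy w xs)
      = - (\<Sum>j = 1..?M. eps \<nu> \<alpha> j * int (fst (state (cf_word \<nu> \<alpha> j) (tail_of lam' j)) * lam' j))"
    using energy_sum[of 1 lam'] M e1 by (simp add: xs w_def split: if_splits)
  define rr where "rr = (if t then fst (state w xs) else snd (state w xs))"
  define n where "n = int l * int rr + (if t then - energy w xs else energy w xs)"
  have "of_nat l ^ 2 / p0 = of_nat l ^ 2 * of_nat (zseq \<nu> (int \<alpha>)) / of_nat (yseq \<nu> (int \<alpha> + 1))"
    unfolding p0 cfrac_eq[OF pos] by simp
  then have "of_nat l ^ 2 / p0 + 1 / 2 * (lam_tilde \<nu> \<alpha> lam \<bullet> (Bmat \<nu> \<alpha> *\<^sub>v lam_tilde \<nu> \<alpha> lam))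
     = of_int n"
  proof -
    have z: "lam' 0 = 0" by (simp add: lam'_def)
    have "of_int n = (of_nat l * of_nat rr - (\<Sum>j = 1..?M. of_int (eps \<nu> \<alpha> j)
        * of_nat (fst (state (cf_word \<nu> \<alpha> j) (tail_of lam' j)) * lam' j)) :: rat)"
      unfolding n_def en by simp
    then show ?thesis using quadratic_form[OF z l0] \<open>of_nat l ^ 2 / p0 = _\<close>
      unfolding st0(2) z rr_def lt by (simp only: add_0_left add_0_right add.commute)
  qed
  then have qq: "qpow \<nu> \<alpha> (of_nat l ^ 2 / p0) *
      qpow \<nu> \<alpha> (1 / 2 * (lam_tilde \<nu> \<alpha> lam \<bullet> (Bmat \<nu> \<alpha> *\<^sub>v lam_tilde \<nu> \<alpha> lam))) = q powi n"
    using qpow_mult[OF p0_exponent_integral[OF pos p0] Theta_exponent_integral[OF pos]]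
    unfolding q_def qpow_of_int[symmetric] by simp
  have "weight (if t then inverse q else q) w xs = weight (q powi eps \<nu> \<alpha> 1) w xs"
    unfolding e1 by (simp add: power_int_minus)
  also have "\<dots> = (\<Prod>j = 1..?M. qfact (q powi eps \<nu> \<alpha> j) (lam' j))"
    unfolding w_def xs using weight_prod[of 1] M by simp
  also have "\<dots> = (\<Prod>j = 1..?M.
       qpoch (qpow \<nu> \<alpha> (of_int (eps \<nu> \<alpha> j))) (qpow \<nu> \<alpha> (of_int (eps \<nu> \<alpha> j))) (lam j))"
    by (rule prod.cong) (simp_all add: eq qpow_of_int q_def)
  finally show "qpow \<nu> \<alpha> (of_nat l ^ 2 / p0) *
      (qpow \<nu> \<alpha> (1 / 2 * (lam_tilde \<nu> \<alpha> lam \<bullet> (Bmat \<nu> \<alpha> *\<^sub>v lam_tilde \<nu> \<alpha> lam)))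
        / (\<Prod>j = 1..msize \<nu> \<alpha>.
             qpoch (qpow \<nu> \<alpha> (of_int (eps \<nu> \<alpha> j))) (qpow \<nu> \<alpha> (of_int (eps \<nu> \<alpha> j))) (lam j)))
     = q powi (int l * int (if t then fst (state w xs) else snd (state w xs))
              + (if t then - energy w xs else energy w xs))
      / weight (if t then inverse q else q) w xs"
    unfolding times_divide_eq_right qq n_def rr_def by simp
qed

lemma bij_betw_lams:
  shows "bij_betw (\<lambda>lam. map lam [1..<Suc (msize \<nu> \<alpha>)]) (lams \<nu> \<alpha> l)
    (total_configs (cf_word \<nu> \<alpha> 1) l)"
proof -
  let ?M = "msize \<nu> \<alpha>"
  let ?g = "\<lambda>xs. \<lambda>j\<in>{1..?M}. (xs ! (j - 1) :: nat)"
  have M: "0 < ?M" by (rule msize_pos)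
  have len: "Suc (length (cf_word \<nu> \<alpha> 1)) = ?M" using M by (simp add: cf_word_def)
  have total: "fst (state (cf_word \<nu> \<alpha> 1) (map lam [1..<Suc ?M])) + snd (state (cf_word \<nu> \<alpha> 1) (map lam [1..<Suc ?M]))
      = (\<Sum>j = 1..?M. nseq \<nu> \<alpha> j * lam j)" for lam
    using spair_total[of lam] unfolding tail_of_def .
  have inv: "map (?g xs) [1..<Suc ?M] = xs" if "length xs = ?M" for xs
    using that by (intro nth_equalityI) (auto simp del: upt_Suc)
  show ?thesis
  proof (rule bij_betw_byWitness[where f' = ?g])
    show "\<forall>lam\<in>lams \<nu> \<alpha> l. ?g (map lam [1..<Suc ?M]) = lam"
      by (auto simp: lams_def fun_eq_iff restrict_def PiE_iff extensional_def simp del: upt_Suc)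
    show "\<forall>xs\<in>total_configs (cf_word \<nu> \<alpha> 1) l. map (?g xs) [1..<Suc ?M] = xs"
      using inv len by (auto simp: total_configs_def)
    show "(\<lambda>lam. map lam [1..<Suc ?M]) ` lams \<nu> \<alpha> l \<subseteq> total_configs (cf_word \<nu> \<alpha> 1) l"
      using len total by (auto simp: total_configs_def lams_def simp del: upt_Suc)
    show "?g ` total_configs (cf_word \<nu> \<alpha> 1) l \<subseteq> lams \<nu> \<alpha> l"
    proof (rule image_subsetI)
      fix xs assume xs: "xs \<in> total_configs (cf_word \<nu> \<alpha> 1) l"
      then have "length xs = ?M" using len by (simp add: total_configs_def)
      then show "?g xs \<in> lams \<nu> \<alpha> l"
        using xs total[of "?g xs"] inv[of xs] by (auto simp: total_configs_def lams_def)
    qed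
  qed
qed

lemma refined_identity:
  assumes p0: "p0 = cfrac (map \<nu> [0..<\<alpha> + 1])"
  defines "q \<equiv> qpow \<nu> \<alpha> 1"
  shows "qpow \<nu> \<alpha> (of_nat l ^ 2 / p0) * Vser \<nu> \<alpha> l =
    (\<Sum>(k, m) | m \<le> k \<and> k * yseq \<nu> (int \<alpha> + 1) + m * yseq \<nu> (int \<alpha>) = l.
       bosonic_coeff (q powi ((-1) ^ \<alpha>)) k m *
       q ^ ((k * yseq \<nu> (int \<alpha> + 1) + m * yseq \<nu> (int \<alpha>)) * (k * zseq \<nu> (int \<alpha>) + m * zseq \<nu> (int \<alpha> - 1))))"
proof -
  let ?w = "cf_word \<nu> \<alpha> 1" and ?t = "outer \<nu> \<alpha> 0"
  let ?Y = "\<lambda>k m. k * yseq \<nu> (int \<alpha> + 1) + m * yseq \<nu> (int \<alpha>)"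
  let ?N = "\<lambda>k m. k * zseq \<nu> (int \<alpha>) + m * zseq \<nu> (int \<alpha> - 1)"
  let ?c = "bosonic_coeff (q powi ((-1) ^ \<alpha>))"
  have y: "yseq \<nu> (int \<alpha> + 1) > 0"
    using yseq_pos[of "\<alpha> + 1" \<nu>] pos by (auto simp: algebra_simps)
  have g: "generic q" using generic_fls_X_intpow[OF y] by (simp add: q_def qpow_def)
  have w0: "cf_word \<nu> \<alpha> 0 = ?t # ?w"
    using cf_word_Cons[OF msize_pos] by simp
  have eb: "inverse (end_base q (?t # ?w)) = q powi ((-1) ^ \<alpha>)"
    using end_base_cf_word[of 0 q] unfolding w0[symmetric] eps_0 eps_end by (simp add: power_int_minus)
  have "qpow \<nu> \<alpha> (of_nat l ^ 2 / p0) * Vser \<nu> \<alpha> l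
     = (\<Sum>xs\<in>total_configs ?w l.
      q powi (int l * int (if ?t then fst (state ?w xs) else snd (state ?w xs))
              + (if ?t then - energy ?w xs else energy ?w xs))
      / weight (if ?t then inverse q else q) ?w xs)"
    unfolding Vser_def sum_distrib_left q_def
    by (subst sum.reindex_bij_betw[OF bij_betw_lams, symmetric])
      (intro sum.cong refl Vser_term(1)[OF p0])
  also have "\<dots> = (\<Sum>k\<le>l. \<Sum>m\<le>k. ?c k m * (if ?Y k m = l then q ^ (l * ?N k m) else 0))"
    unfolding fermionic_identity[OF g] eb unfolding w0[symmetric] coord_cf_word fst_conv snd_conv ..
  also have "\<dots> = (\<Sum>(k, m)\<in>(SIGMA k:{..l}. {..k}). ?c k m * (if ?Y k m = l then q ^ (l * ?N k m) else 0))"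
    by (rule sum.Sigma) auto
  also have "\<dots> = (\<Sum>(k, m) | m \<le> k \<and> ?Y k m = l. ?c k m * q ^ (?Y k m * ?N k m))"
  proof (rule sum.mono_neutral_cong_right)
    have "k \<le> ?Y k m" for k m using y by (simp add: trans_le_add1)
    then show "{(k, m). m \<le> k \<and> ?Y k m = l} \<subseteq> (SIGMA k:{..l}. {..k})" by auto
  qed (auto split: if_splits)
  finally show ?thesis .
qed

section \<open>Summation over all degrees\<close>

definition bosonic_term :: "nat \<times> nat \<Rightarrow> rat fls" where
  "bosonic_term = (\<lambda>(k, m).
     bosonic_coeff (qpow \<nu> \<alpha> 1 powi ((-1) ^ \<alpha>)) k m *
     qpow \<nu> \<alpha> 1 ^ ((k * yseq \<nu> (int \<alpha> + 1) + m * yseq \<nu> (int \<alpha>))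
       * (k * zseq \<nu> (int \<alpha>) + m * zseq \<nu> (int \<alpha> - 1))))"

lemma yseq_end_pos: "yseq \<nu> (int \<alpha> + 1) > 0"
  using yseq_pos[of "\<alpha> + 1" \<nu>] pos by (auto simp: algebra_simps)

lemma zseq_end_pos: "zseq \<nu> (int \<alpha>) > 0"
  unfolding zseq_eq_yseq by (rule yseq_pos) (use pos in auto)

lemma qpow_1: "qpow \<nu> \<alpha> 1 = fls_X_intpow (int (yseq \<nu> (int \<alpha> + 1)))"
  by (simp add: qpow_def)

lemma generic_qpow_1: "generic (qpow \<nu> \<alpha> 1)"
  unfolding qpow_1 by (rule generic_fls_X_intpow[OF yseq_end_pos])

lemma bosonic_term_zero: "bosonic_term (0, 0) = 1"
  by (simp add: bosonic_term_def bosonic_coeff_def)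

lemma bosonic_term_eq:
  assumes "m \<le> k" "k > 0"
  defines "q \<equiv> qpow \<nu> \<alpha> 1"
  shows "bosonic_term (k, m) =
     (-1) powi ((1 + (-1) ^ \<alpha>) div 2 * int k + int m)
           * q powi (int ((k * yseq \<nu> (int \<alpha> + 1) + m * yseq \<nu> (int \<alpha>))
                          * (k * zseq \<nu> (int \<alpha>) + m * zseq \<nu> (int \<alpha> - 1)))
                     + Delta \<alpha> k m)
           * (Qpoly ((-1) ^ \<alpha>) q k m / qpoch q q k)"
proof -
  let ?E = "(k * yseq \<nu> (int \<alpha> + 1) + m * yseq \<nu> (int \<alpha>))
                          * (k * zseq \<nu> (int \<alpha>) + m * zseq \<nu> (int \<alpha> - 1))"
  have g: "generic q" unfolding q_def by (rule generic_qpow_1)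
  have add: "q powi (int a + int b) = q ^ a * q ^ b" for a b
    unfolding of_nat_add[symmetric] power_int_of_nat power_add ..
  have sgn: "(-1) powi (int k + int m) = ((-1) ^ (k + m) :: rat fls)"
    unfolding of_nat_add[symmetric] power_int_of_nat ..
  show ?thesis
  proof (cases "even \<alpha>")
    case True
    then have D: "Delta \<alpha> k m = int ((k - m) choose 2)" by (simp add: Delta_def)
    show ?thesis unfolding D add bosonic_term_def q_def[symmetric]
      using True by (simp add: bosonic_coeff_even[OF assms(1,2)] sgn)
  next
    case False
    then have D: "Delta \<alpha> k m = int (m choose 2)" by (simp add: Delta_def)
    show ?thesis unfolding D add bosonic_term_def q_def[symmetric]
      using False by (simp add: bosonic_coeff_odd[OF g assms(1,2)] power_int_minus)
  qed
qed

text \<open>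
  Both linear forms \<open>k y\<^sub>\<alpha>\<^sub>+\<^sub>1 + m y\<^sub>\<alpha>\<close> and \<open>k z\<^sub>\<alpha> + m z\<^bsub>\<alpha>-1\<^esub>\<close> are at least \<open>k\<close>, and all other factors have no pole at
  \<open>q = 0\<close>. As \<open>m \<le> k\<close>, this yields the convergence of the right-hand side.
\<close>

lemma bosonic_term_order:
  assumes "m \<le> k"
  shows "fls_order_ge (int k) (bosonic_term (k, m))"
proof (cases "k = 0")
  case True
  then show ?thesis using assms by (simp add: bosonic_term_zero fls_order_ge_def)
next
  case False
  let ?y = "yseq \<nu> (int \<alpha> + 1)"
  let ?q = "fls_X_intpow (int ?y) :: rat fls"
  let ?Y = "k * ?y + m * yseq \<nu> (int \<alpha>)"
  let ?N = "k * zseq \<nu> (int \<alpha>) + m * zseq \<nu> (int \<alpha> - 1)"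
  have k: "k > 0" using False by simp
  have D: "0 \<le> Delta \<alpha> k m" by (cases "even \<alpha>") (simp_all add: Delta_def)
  have "k \<le> ?Y" "k \<le> ?N" using yseq_end_pos zseq_end_pos by (simp_all add: trans_le_add1)
  then have "k * 1 \<le> 1 * (?Y * ?N)" unfolding mult_1 using k by (intro mult_le_mono) auto
  also have "1 * (?Y * ?N) \<le> ?y * (?Y * ?N)" using yseq_end_pos by (intro mult_le_mono1) simp
  finally have "int k \<le> int ?y * int (?Y * ?N)" unfolding of_nat_mult[symmetric] of_nat_le_iff by simp
  also have "\<dots> \<le> int ?y * (int (?Y * ?N) + Delta \<alpha> k m)" using D by (intro mult_left_mono) auto
  finally have e: "fls_order_ge (int k) (?q powi (int (?Y * ?N) + Delta \<alpha> k m))"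
    by (rule fls_order_ge_powi)
  have "(-1) ^ \<alpha> = (1::int) \<or> (-1) ^ \<alpha> = (-1::int)" by (cases "even \<alpha>") auto
  from fls_order_ge_divide_qfact[OF fls_order_ge_Qpoly[OF yseq_end_pos k assms this] yseq_end_pos]
  have Q: "fls_order_ge 0 (Qpoly ((-1) ^ \<alpha>) ?q k m / qfact ?q k)" .
  have s: "fls_order_ge 0 ((-1 :: rat fls) powi i)" for i
    by (cases "even i") (simp_all add: power_int_minus_left fls_order_ge_def)
  show ?thesis
    using fls_order_ge_mult[OF fls_order_ge_mult[OF s e] Q]
    unfolding bosonic_term_eq[OF assms k] qpow_1 by simp
qed

lemma bosonic_term_finite:
  "finite {x \<in> {(k, m). m \<le> k}. \<exists>i\<le>n. fls_nth (bosonic_term x) i \<noteq> 0}"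
proof (rule finite_subset)
  show "{x \<in> {(k, m). m \<le> k}. \<exists>i\<le>n. fls_nth (bosonic_term x) i \<noteq> 0} \<subseteq> {..nat n} \<times> {..nat n}"
  proof (rule subsetI)
    fix x assume x: "x \<in> {x \<in> {(k, m). m \<le> k}. \<exists>i\<le>n. fls_nth (bosonic_term x) i \<noteq> 0}"
    obtain k m where km: "x = (k, m)" by fastforce
    with x obtain i where mk: "m \<le> k" and i: "i \<le> n" "fls_nth (bosonic_term (k, m)) i \<noteq> 0" by auto
    have "\<not> i < int k" using fls_order_ge_nth[OF bosonic_term_order[OF mk], of i] i by auto
    then show "x \<in> {..nat n} \<times> {..nat n}" using km mk i by auto
  qed
qed auto

end

theorem theorem2p3:
  fixes p0 :: rat and \<nu> :: "nat \<Rightarrow> nat" and \<alpha> :: nat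
  assumes "p0 \<ge> 1"
    and "\<forall>i\<le>\<alpha>. \<nu> i > 0"
    and "\<alpha> > 0 \<longrightarrow> \<nu> \<alpha> \<ge> 2"
    and "p0 = cfrac (map \<nu> [0..<\<alpha> + 1])"
  shows
    "let q = qpow \<nu> \<alpha> 1;
         lhs = (\<lambda>l::nat. qpow \<nu> \<alpha> (of_nat l ^ 2 / p0) * Vser \<nu> \<alpha> l);
         I = {(k::nat, m::nat). k \<ge> m \<and> (k, m) \<noteq> (0, 0)};
         rhs = (\<lambda>(k, m).
           (-1) powi ((1 + (-1) ^ \<alpha>) div 2 * int k + int m)
           * q powi (int ((k * yseq \<nu> (int \<alpha> + 1) + m * yseq \<nu> (int \<alpha>))
                          * (k * zseq \<nu> (int \<alpha>) + m * zseq \<nu> (int \<alpha> - 1)))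
                     + Delta \<alpha> k m)
           * (Qpoly ((-1) ^ \<alpha>) q k m / qpoch q q k))
     in lhs summable_on UNIV \<and> rhs summable_on I
        \<and> (\<Sum>\<^sub>\<infinity>l. lhs l) = 1 + (\<Sum>\<^sub>\<infinity>(k, m) \<in> I. rhs (k, m))"
proof -
  interpret continued_fraction \<nu> \<alpha> by unfold_locales (rule assms(2))
  define q where "q = qpow \<nu> \<alpha> 1"
  define lhs where "lhs = (\<lambda>l::nat. qpow \<nu> \<alpha> (of_nat l ^ 2 / p0) * Vser \<nu> \<alpha> l)"
  define I where "I = {(k::nat, m::nat). k \<ge> m \<and> (k, m) \<noteq> (0, 0)}"
  define rhs where "rhs = (\<lambda>(k, m).
           (-1) powi ((1 + (-1) ^ \<alpha>) div 2 * int k + int m)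
           * q powi (int ((k * yseq \<nu> (int \<alpha> + 1) + m * yseq \<nu> (int \<alpha>))
                          * (k * zseq \<nu> (int \<alpha>) + m * zseq \<nu> (int \<alpha> - 1)))
                     + Delta \<alpha> k m)
           * (Qpoly ((-1) ^ \<alpha>) q k m / qpoch q q k))"
  define J where "J = {(k::nat, m::nat). m \<le> k}"
  let ?Y = "\<lambda>(k, m). k * yseq \<nu> (int \<alpha> + 1) + m * yseq \<nu> (int \<alpha>)"
  let ?c = "\<lambda>A i. \<Sum>x | x \<in> A \<and> fls_nth (bosonic_term x) i \<noteq> 0. fls_nth (bosonic_term x) i"
  have J: "J = insert (0, 0) I" "(0, 0) \<notin> I" "I \<subseteq> J" by (auto simp: I_def J_def)
  have finJ: "finite {x \<in> J. \<exists>i\<le>n. fls_nth (bosonic_term x) i \<noteq> 0}" for n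
    unfolding J_def by (rule bosonic_term_finite)
  then have finI: "finite {x \<in> I. \<exists>i\<le>n. fls_nth (bosonic_term x) i \<noteq> 0}" for n
    by (rule finite_subset[rotated]) (use J in auto)
  have "fls_order_ge 0 (bosonic_term x)" if "x \<in> I" for x
    using that bosonic_term_order by (auto simp: I_def intro!: fls_order_ge_mono[of "int _" _ 0])
  then obtain s where s: "fls_nth s i = ?c I i" for i
    using fls_coefficient_sum_exists[of I bosonic_term] by blast
  have rhs: "rhs x = bosonic_term x" if "x \<in> I" for x
    using that bosonic_term_eq by (auto simp: I_def rhs_def q_def)
  have "(bosonic_term has_sum s) I" by (rule fls_has_sumI[OF finI s])
  then have rhs_sum: "(rhs has_sum s) I" by (rule has_sum_cong[THEN iffD2, rotated]) (rule rhs)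
  have "fls_nth (1 + s) i = ?c J i" for i
  proof -
    let ?SI = "{x. x \<in> I \<and> fls_nth (bosonic_term x) i \<noteq> 0}"
    let ?SJ = "{x. x \<in> J \<and> fls_nth (bosonic_term x) i \<noteq> 0}"
    have "finite ?SI" by (rule finite_subset[OF _ finI[of i]]) auto
    \<comment> \<open>The index \<open>(0, 0)\<close> accounts for the summand 1 of the right-hand side.\<close>
    moreover have "?SJ = (if fls_nth (1 :: rat fls) i \<noteq> 0 then insert (0, 0) ?SI else ?SI)"
      using J(1) bosonic_term_zero by auto
    ultimately show ?thesis using J(2) s[of i] bosonic_term_zero by auto
  qed
  moreover have "finite {x \<in> J. ?Y x = l}" for l
  proof (rule finite_subset)
    have "k \<le> k * yseq \<nu> (int \<alpha> + 1) + m * yseq \<nu> (int \<alpha>)" for k m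
      using yseq_end_pos by (simp add: trans_le_add1)
    then show "{x \<in> J. ?Y x = l} \<subseteq> {..l} \<times> {..l}" by (auto simp: J_def intro: le_trans)
  qed auto
  ultimately have "((\<lambda>l. \<Sum>x | x \<in> J \<and> ?Y x = l. bosonic_term x) has_sum (1 + s)) UNIV"
    by (intro fls_has_sum_fibres finJ)
  also have "(\<lambda>l. \<Sum>x | x \<in> J \<and> ?Y x = l. bosonic_term x) = lhs"
    unfolding lhs_def refined_identity[OF assms(4)]
    by (intro ext sum.cong) (auto simp: J_def bosonic_term_def)
  finally have lhs_sum: "(lhs has_sum (1 + s)) UNIV" .
  have "infsum lhs UNIV = 1 + infsum rhs I"
    using infsumI[OF lhs_sum] infsumI[OF rhs_sum] by simp
  then have "lhs summable_on UNIV \<and> rhs summable_on I \<and> (\<Sum>\<^sub>\<infinity>l. lhs l) = 1 + (\<Sum>\<^sub>\<infinity>(k, m) \<in> I. rhs (k, m))"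
    using lhs_sum rhs_sum by (auto simp: summable_on_def)
  then show ?thesis unfolding Let_def lhs_def rhs_def I_def q_def .
qed

end
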